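(* Let $K$ be a field with algebraic closure $\overline{K}$, let $f\in K[X_1,\dots,X_n]$ be absolutely irreducible of degree $\delta$, and let $1\le D\le\delta-1$. For $\nu_1,\dots,\nu_n,\omega_2,\dots,\omega_n\in\overline{K}$ set $$\chi(X,Y,Z_2,\dots,Z_n):=f(X+\nu_1,\ \omega_2X+Z_2Y+\nu_2,\ \dots,\ \omega_nX+Z_nY+\nu_n)\in\overline{K}[X,Y,Z_2,\dots,Z_n].$$ Let $\Upsilon\in K[V_1,\dots,V_n,W_2,\dots,W_n]$ be a nonzero polynomial of degree at most $2\delta^2$ such that whenever $\Upsilon(\nu_1,\dots,\nu_n,\omega_2,\dots,\omega_n)\ne0$ the following hold: the leading coefficient of $\chi$ with respect to $X$ is a nonzero element of $\overline{K}$; the discriminant of $\chi(X,0,Z_2,\dots,Z_n)$ with respect to $X$ is nonzero; and $\chi$ is irreducible in $\overline{K}[X,Y,Z_2,\dots,Z_n]$. Suppose $\Upsilon(\nu_1,\dots,\nu_n,\omega_2,\dots,\omega_n)\ne0$. Then there exists a nonzero polynomial $\Psi_D\in\overline{K}[Z_2,\dots,Z_n]$ with $$\deg\Psi_D\le D\delta^2(D+1)(D+2)-\frac{(D^2+3D)(D^2+3D+2)\delta}{8}$$ such that for every $\eta=(\eta_2,\dots,\eta_n)\in\overline{K}^{\,n-1}$ with $\Psi_D(\eta)\ne0$, the bivariate polynomial $\chi(X,Y,\eta)=f(X+\nu_1,\omega_2X+\eta_2Y+\nu_2,\dots,\omega_nX+\eta_nY+\nu_n)$ has no irreducible factor of degree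 at most $D$ in $\overline{K}[X,Y]$.
   Context: A polynomial over $K$ is absolutely irreducible if it is irreducible in $\overline{K}[X_1,\dots,X_n]$. (Such a polynomial $\Upsilon$ is known to exist, by work of Kaltofen.) *)

theory Defs
  imports
    "HOL-Library.Poly_Mapping"
    "HOL-Algebra.Algebraic_Closure_Type"
    "Subresultants.Resultant_Prelim"
begin

text \<open>
  Polynomials in indeterminates of type \<open>'v\<close> are finitely supported maps from monomials to
  coefficients, with the convolution product of \<open>Poly_Mapping\<close>.  The type \<open>'v\<close> may have more
  elements than there are indeterminates at hand; the ring \<open>R[X\<^sub>i : i \<in> V]\<close> is the subring
  \<open>mpolys V\<close>.
\<close>

type_synonym ('v, 'a) mpoly = "('v \<Rightarrow>\<^sub>0 nat) \<Rightarrow>\<^sub>0 'a"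

definition Const :: "'a \<Rightarrow> ('v, 'a::zero) mpoly" where
  "Const c = Poly_Mapping.single 0 c"

definition Var :: "'v \<Rightarrow> ('v, 'a::zero_neq_one) mpoly" where
  "Var i = Poly_Mapping.single (Poly_Mapping.single i 1) 1"

definition mpolys :: "'v set \<Rightarrow> ('v, 'a::zero) mpoly set" where
  "mpolys V = {p. \<forall>m \<in> Poly_Mapping.keys p. Poly_Mapping.keys m \<subseteq> V}"

definition monom_degree :: "('v \<Rightarrow>\<^sub>0 nat) \<Rightarrow> nat" where
  "monom_degree m = (\<Sum>i \<in> Poly_Mapping.keys m. Poly_Mapping.lookup m i)"

definition total_degree :: "('v, 'a::zero) mpoly \<Rightarrow> nat" where
  "total_degree p = Max (insert 0 (monom_degree ` Poly_Mapping.keys p))"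

text \<open>
  The value of \<open>p\<close> under the map that acts as \<open>h\<close> on coefficients and sends the indeterminate
  \<open>i\<close> to \<open>\<sigma> i\<close>.
\<close>

definition subst :: "('a::zero \<Rightarrow> 'b) \<Rightarrow> ('v \<Rightarrow> 'b) \<Rightarrow> ('v, 'a) mpoly \<Rightarrow> 'b::comm_semiring_1" where
  "subst h \<sigma> p = (\<Sum>m \<in> Poly_Mapping.keys p.
     h (Poly_Mapping.lookup p m) * (\<Prod>i \<in> Poly_Mapping.keys m. \<sigma> i ^ Poly_Mapping.lookup m i))"

definition dvd_in :: "'r::comm_ring_1 set \<Rightarrow> 'r \<Rightarrow> 'r \<Rightarrow> bool" where
  "dvd_in R a b \<longleftrightarrow> (\<exists>q\<in>R. b = a * q)"

definition irreducible_in :: "'r::comm_ring_1 set \<Rightarrow> 'r \<Rightarrow> bool" where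
  "irreducible_in R p \<longleftrightarrow> p \<in> R \<and> p \<noteq> 0 \<and> \<not> dvd_in R p 1 \<and>
     (\<forall>a\<in>R. \<forall>b\<in>R. p = a * b \<longrightarrow> dvd_in R a 1 \<or> dvd_in R b 1)"

definition absolutely_irreducible :: "'v set \<Rightarrow> ('v, 'k::field) mpoly \<Rightarrow> bool" where
  "absolutely_irreducible V f \<longleftrightarrow> irreducible_in (mpolys V) (Poly_Mapping.map to_ac f)"

text \<open>\<open>p\<close> as a univariate polynomial in the indeterminate \<open>x\<close> over the remaining ones.\<close>

definition as_poly_in :: "'v \<Rightarrow> ('v, 'a::comm_ring_1) mpoly \<Rightarrow> ('v, 'a) mpoly poly" where
  "as_poly_in x p = subst (\<lambda>c. [:Const c:]) (\<lambda>i. if i = x then [:0, 1:] else [:Var i:]) p"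

text \<open>
  For \<open>p\<close> of degree \<open>d \<ge> 1\<close> with leading coefficient \<open>a\<close>, the discriminant \<open>\<Delta>\<close> is defined by
  \<open>a \<Delta> = (-1)\<^bsup>d(d-1)/2\<^esup> Res(p, p')\<close>.  The derivative is treated as a polynomial of formal
  degree \<open>d - 1\<close>, since its actual degree may be smaller in positive characteristic.
\<close>

definition discriminant :: "'a::idom poly \<Rightarrow> 'a" where
  "discriminant p = (let d = Polynomial.degree p in
     THE \<Delta>. Polynomial.lead_coeff p * \<Delta> =
            (- 1) ^ (d * (d - 1) div 2) * resultant_sub d (d - 1) p (pderiv p))"

lemma lead_coeff_times_discriminant:
  fixes p :: "'a::idom poly"
  defines "d \<equiv> Polynomial.degree p"
  assumes d: "d \<ge> 1"
  shows "Polynomial.lead_coeff p * discriminant p =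
           (- 1) ^ (d * (d - 1) div 2) * resultant_sub d (d - 1) p (pderiv p)"
proof -
  let ?a = "Polynomial.lead_coeff p"
  let ?S = "sylvester_mat_sub d (d - 1) p (pderiv p)"
  let ?r = "(- 1) ^ (d * (d - 1) div 2) * resultant_sub d (d - 1) p (pderiv p)"
  have S: "?S \<in> carrier_mat (d + (d - 1)) (d + (d - 1))"
    by (rule sylvester_mat_sub_carrier)
  have entry: "?a dvd ?S $$ (i, 0)" if "i < d + (d - 1)" for i
  proof (cases "Suc i = d")
    case True
    then show ?thesis
      using d by (auto simp: sylvester_mat_sub_def coeff_pderiv d_def)
  next
    case False
    then show ?thesis
      using that d by (auto simp: sylvester_mat_sub_def d_def)
  qed
  have "det ?S = (\<Sum>i<d + (d - 1). ?S $$ (i, 0) * cofactor ?S i 0)"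
    using laplace_expansion_column[OF S, of 0] d by simp
  also have "?a dvd \<dots>"
    by (intro dvd_sum dvd_mult2 entry) auto
  finally have "?a dvd ?r"
    by (simp add: resultant_sub_def)
  then obtain \<Delta> where \<Delta>: "?r = ?a * \<Delta>" ..
  have "?a \<noteq> 0"
    using d by (auto simp: d_def)
  then have "discriminant p = \<Delta>"
    unfolding discriminant_def Let_def
    by (intro the_equality) (use \<Delta> in \<open>auto simp: d_def\<close>)
  with \<Delta> show ?thesis by simp
qed

text \<open>
  In the ring containing \<open>\<chi>\<close>, the indeterminates are numbered so that \<open>X\<close> is \<open>0\<close>, \<open>Y\<close> is \<open>1\<close> and
  \<open>Z\<^sub>i\<close> is \<open>i\<close> for \<open>i \<ge> 2\<close>.
\<close>

abbreviation (input) X_ix :: nat where "X_ix \<equiv> 0"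
abbreviation (input) Y_ix :: nat where "Y_ix \<equiv> 1"

definition chi ::
    "(nat, 'k::field) mpoly \<Rightarrow> (nat \<Rightarrow> 'k alg_closure) \<Rightarrow> (nat \<Rightarrow> 'k alg_closure) \<Rightarrow>
     (nat, 'k alg_closure) mpoly" where
  "chi f \<nu> \<omega> = subst (\<lambda>c. Const (to_ac c))
     (\<lambda>i. if i = 1 then Var X_ix + Const (\<nu> 1)
          else Const (\<omega> i) * Var X_ix + Var i * Var Y_ix + Const (\<nu> i)) f"

definition at_Y_zero :: "(nat, 'a::comm_ring_1) mpoly \<Rightarrow> (nat, 'a) mpoly" where
  "at_Y_zero p = subst Const (\<lambda>i. if i = Y_ix then 0 else Var i) p"

definition at_Z :: "(nat \<Rightarrow> 'a) \<Rightarrow> (nat, 'a::comm_ring_1) mpoly \<Rightarrow> (nat, 'a) mpoly" where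
  "at_Z \<eta> p = subst Const (\<lambda>i. if i = X_ix \<or> i = Y_ix then Var i else Const (\<eta> i)) p"

definition good_point ::
    "nat \<Rightarrow> (nat, 'k::field) mpoly \<Rightarrow> (nat \<Rightarrow> 'k alg_closure) \<Rightarrow> (nat \<Rightarrow> 'k alg_closure) \<Rightarrow> bool" where
  "good_point n f \<nu> \<omega> \<longleftrightarrow>
     (\<exists>c. c \<noteq> 0 \<and> Polynomial.lead_coeff (as_poly_in X_ix (chi f \<nu> \<omega>)) = Const c) \<and>
     discriminant (as_poly_in X_ix (at_Y_zero (chi f \<nu> \<omega>))) \<noteq> 0 \<and>
     irreducible_in (mpolys ({X_ix, Y_ix} \<union> {2..n})) (chi f \<nu> \<omega>)"

end

theory Submission
  imports Defs
begin

text \<open>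
  The polynomial \<open>\<chi>(X, 0, Z) = f(X + \<nu>\<^sub>1, \<omega>\<^sub>i X + \<nu>\<^sub>i)\<close> does not involve \<open>Z\<close> and has only simple roots, all in
  the algebraically closed ground field.  By Newton iteration each root \<open>x\<close> lifts to a root \<open>\<alpha>\<close> of \<open>\<chi>\<close> modulo
  \<open>Y\<^bsup>K+1\<^esup>\<close>, \<open>K = 2D\<delta>\<close>, whose coefficient of \<open>Y\<^bsup>k\<^esup>\<close> has degree at most \<open>k\<close> in \<open>Z\<close>.  The condition that some
  \<open>h\<close> of degree at most \<open>D\<close> in \<open>X, Y\<close> satisfies \<open>h(\<alpha>, Y) = 0\<close> modulo \<open>Y\<^bsup>K+1\<^esup>\<close> is a linear system in the
  \<open>N = (D+1)(D+2)/2\<close> coefficients of \<open>h\<close>.  Over the polynomials in \<open>Z\<close> it has no nonzero solution: the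
  resultant of \<open>\<chi>\<close> and \<open>h\<close> with respect to \<open>X\<close> has degree at most \<open>K\<close> in \<open>Y\<close> and is divisible by \<open>Y\<^bsup>K+1\<^esup>\<close>,
  so it vanishes and the prime \<open>\<chi>\<close>, of degree \<open>\<delta> > D\<close> in \<open>X, Y\<close>, divides \<open>h\<close>.  Hence some \<open>N \<times> N\<close> minor is
  nonzero; \<open>\<Psi>\<close> is the product of these minors over the at most \<open>\<delta>\<close> roots \<open>x\<close>.  If \<open>h\<close> is a factor of
  \<open>\<chi>(X, Y, \<eta>)\<close>, then \<open>h(X, 0)\<close> has a root \<open>x\<close>, the specialization of \<open>\<alpha>\<close> at \<open>\<eta>\<close> is a root of \<open>h\<close> modulo
  \<open>Y\<^bsup>K+1\<^esup>\<close>, and the minor of \<open>x\<close> vanishes at \<open>\<eta>\<close>.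
\<close>

section \<open>Substitution homomorphisms\<close>

lemma comm_ring_homI:
  assumes "h 1 = 1" "\<And>x y. h (x + y) = h x + h y" "\<And>x y. h (x * y) = h x * h y"
  shows "comm_ring_hom (h :: 'a::comm_ring_1 \<Rightarrow> 'b::comm_ring_1)"
proof -
  have "h 0 + h 0 = h 0 + 0"
    using assms(2)[of 0 0] by simp
  then have "h 0 = 0"
    by (simp only: add_left_cancel)
  with assms show ?thesis
    by unfold_locales
qed

lemma comm_ring_hom_comp:
  assumes "comm_ring_hom g" "comm_ring_hom h"
  shows "comm_ring_hom (\<lambda>x. g (h x))"
proof -
  interpret g: comm_ring_hom g by fact
  interpret h: comm_ring_hom h by fact
  show ?thesis by (rule comm_ring_homI) (simp_all add: g.hom_add h.hom_add g.hom_mult h.hom_mult)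
qed

lemma comm_ring_hom_id: "comm_ring_hom (\<lambda>x. x)"
  by (rule comm_ring_homI) auto

lemma comm_ring_hom_pCons_0: "comm_ring_hom (\<lambda>c. [:c:])"
  by (rule comm_ring_homI) (auto simp: one_pCons)

lemma comm_ring_hom_poly: "comm_ring_hom (\<lambda>p. poly p a)"
  by (rule comm_ring_homI) auto

lemma comm_ring_hom_map_poly:
  assumes "comm_ring_hom h"
  shows "comm_ring_hom (map_poly h)"
proof -
  interpret comm_ring_hom h by fact
  interpret m: map_poly_comm_ring_hom h ..
  show ?thesis by unfold_locales
qed

text \<open>Splitting the monomial part off \<open>subst\<close> isolates a map that turns sums of
  exponents into products; this is what makes \<open>subst\<close> multiplicative.\<close>

definition mon_eval :: "('v \<Rightarrow> 'b) \<Rightarrow> ('v \<Rightarrow>\<^sub>0 nat) \<Rightarrow> 'b::comm_monoid_mult" where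
  "mon_eval \<sigma> m = (\<Prod>i \<in> Poly_Mapping.keys m. \<sigma> i ^ Poly_Mapping.lookup m i)"

text \<open>Indeterminates outside \<open>m\<close> contribute zeroth powers. Values at several
  monomials can then be compared over one common index set.\<close>

lemma mon_eval_superset:
  assumes "finite A" "Poly_Mapping.keys m \<subseteq> A"
  shows "mon_eval \<sigma> m = (\<Prod>i \<in> A. \<sigma> i ^ Poly_Mapping.lookup m i)"
  unfolding mon_eval_def using assms
  by (intro prod.mono_neutral_left) (auto simp: in_keys_iff)

lemma mon_eval_0 [simp]: "mon_eval \<sigma> 0 = 1"
  by (simp add: mon_eval_def)

lemma mon_eval_add: "mon_eval \<sigma> (m + m') = mon_eval \<sigma> m * mon_eval \<sigma> m'"
proof -
  let ?A = "Poly_Mapping.keys m \<union> Poly_Mapping.keys m'"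
  have "Poly_Mapping.keys (m + m') \<subseteq> ?A"
    by (rule Poly_Mapping.keys_add)
  then show ?thesis
    using mon_eval_superset[of ?A "m + m'" \<sigma>] mon_eval_superset[of ?A m \<sigma>] mon_eval_superset[of ?A m' \<sigma>]
    by (simp add: lookup_add power_add prod.distrib)
qed

lemma mon_eval_single: "mon_eval \<sigma> (Poly_Mapping.single i k) = \<sigma> i ^ k"
  by (simp add: mon_eval_def)

lemma comm_ring_hom_mon_eval:
  assumes "comm_ring_hom \<phi>"
  shows "\<phi> (mon_eval \<sigma> m) = mon_eval (\<lambda>i. \<phi> (\<sigma> i)) m"
proof -
  interpret comm_ring_hom \<phi> by fact
  show ?thesis by (simp add: mon_eval_def hom_prod hom_power)
qed

lemma subst_eq_mon_eval:
  "subst h \<sigma> p = (\<Sum>m \<in> Poly_Mapping.keys p. h (Poly_Mapping.lookup p m) * mon_eval \<sigma> m)"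
  by (simp add: subst_def mon_eval_def)

lemma subst_superset:
  assumes "finite A" "Poly_Mapping.keys p \<subseteq> A" "h 0 = 0"
  shows "subst h \<sigma> p = (\<Sum>m \<in> A. h (Poly_Mapping.lookup p m) * mon_eval \<sigma> m)"
  unfolding subst_eq_mon_eval using assms
  by (intro sum.mono_neutral_left) (auto simp: in_keys_iff)

lemma subst_single:
  assumes "h 0 = 0"
  shows "subst h \<sigma> (Poly_Mapping.single m c) = h c * mon_eval \<sigma> m"
  using assms by (simp add: subst_eq_mon_eval)

lemma subst_add:
  assumes "comm_ring_hom h"
  shows "subst h \<sigma> (p + q) = subst h \<sigma> p + subst h \<sigma> q"
proof -
  interpret comm_ring_hom h by fact
  let ?A = "Poly_Mapping.keys p \<union> Poly_Mapping.keys q"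
  have "Poly_Mapping.keys (p + q) \<subseteq> ?A"
    by (rule Poly_Mapping.keys_add)
  then show ?thesis
    using subst_superset[of ?A "p + q" h \<sigma>] subst_superset[of ?A p h \<sigma>]
      subst_superset[of ?A q h \<sigma>]
    by (simp add: lookup_add hom_add distrib_right sum.distrib)
qed

lemma sum_single_lookup:
  "(\<Sum>m \<in> Poly_Mapping.keys p. Poly_Mapping.single m (Poly_Mapping.lookup p m)) = p"
  by (rule poly_mapping_eqI) (auto simp: lookup_sum lookup_single when_def in_keys_iff)

lemma subst_sum:
  assumes "comm_ring_hom h"
  shows "subst h \<sigma> (\<Sum>x\<in>A. g x) = (\<Sum>x\<in>A. subst h \<sigma> (g x))"
  by (induction A rule: infinite_finite_induct)
    (auto simp: subst_add[OF assms], auto simp: subst_def)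

lemma subst_mult:
  assumes "comm_ring_hom h"
  shows "subst h \<sigma> (p * q) = subst h \<sigma> p * subst h \<sigma> q"
proof -
  interpret comm_ring_hom h by fact
  let ?s = "\<lambda>p m. Poly_Mapping.single m (Poly_Mapping.lookup p m)"
  have "p * q = (\<Sum>m \<in> Poly_Mapping.keys p. ?s p m) * (\<Sum>m' \<in> Poly_Mapping.keys q. ?s q m')"
    by (simp only: sum_single_lookup)
  also have "\<dots> = (\<Sum>m \<in> Poly_Mapping.keys p. \<Sum>m' \<in> Poly_Mapping.keys q.
      Poly_Mapping.single (m + m') (Poly_Mapping.lookup p m * Poly_Mapping.lookup q m'))"
    by (simp add: sum_product mult_single)
  finally have "subst h \<sigma> (p * q) = (\<Sum>m \<in> Poly_Mapping.keys p. \<Sum>m' \<in> Poly_Mapping.keys q.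
      h (Poly_Mapping.lookup p m * Poly_Mapping.lookup q m') * mon_eval \<sigma> (m + m'))"
    by (simp only: subst_sum[OF assms] subst_single[of h, OF hom_zero])
  also have "\<dots> = subst h \<sigma> p * subst h \<sigma> q"
    unfolding subst_eq_mon_eval[of h \<sigma> p] subst_eq_mon_eval[of h \<sigma> q] sum_product
    by (intro sum.cong refl) (simp add: hom_mult mon_eval_add ac_simps)
  finally show ?thesis .
qed

lemma comm_ring_hom_subst:
  assumes "comm_ring_hom h"
  shows "comm_ring_hom (subst h \<sigma>)"
proof (rule comm_ring_homI)
  interpret comm_ring_hom h by fact
  show "subst h \<sigma> 1 = 1"
    by (simp add: subst_eq_mon_eval)
qed (auto simp: subst_add[OF assms] subst_mult[OF assms])

lemma comm_ring_hom_Const: "comm_ring_hom Const"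
  by (rule comm_ring_homI) (auto simp: Const_def single_add mult_single)

lemma Const_0 [simp]: "Const 0 = 0"
  and Const_1 [simp]: "Const 1 = 1"
  and Const_eq_0_iff [simp]: "Const c = 0 \<longleftrightarrow> c = 0"
  by (simp_all add: Const_def) (metis lookup_single_eq lookup_zero single_zero)

lemma subst_Const:
  assumes "comm_ring_hom h"
  shows "subst h \<sigma> (Const c) = h c"
proof -
  interpret comm_ring_hom h by fact
  show ?thesis by (simp add: Const_def subst_single)
qed

lemma subst_Var:
  assumes "comm_ring_hom h"
  shows "subst h \<sigma> (Var i) = \<sigma> i"
proof -
  interpret comm_ring_hom h by fact
  show ?thesis by (simp add: Var_def subst_single mon_eval_single)
qed

text \<open>A homomorphism after a substitution is again a substitution. Composites of evaluations
  are therefore compared by their effect on constants and indeterminates alone.\<close>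

lemma hom_subst:
  assumes "comm_ring_hom \<phi>"
  shows "\<phi> (subst h \<sigma> p) = subst (\<lambda>c. \<phi> (h c)) (\<lambda>i. \<phi> (\<sigma> i)) p"
proof -
  interpret comm_ring_hom \<phi> by fact
  show ?thesis by (simp add: subst_eq_mon_eval hom_sum hom_mult comm_ring_hom_mon_eval[OF assms])
qed

lemma mon_eval_Var: "mon_eval Var m = (Poly_Mapping.single m 1 :: ('v, 'a::comm_ring_1) mpoly)"
proof -
  have pow: "Var i ^ k = (Poly_Mapping.single (Poly_Mapping.single i k) 1 :: ('v, 'a) mpoly)" for i k
    by (induction k) (auto simp: Var_def mult_single simp flip: single_add)
  have "(\<Prod>i\<in>A. Var i ^ f i) =
      (Poly_Mapping.single (\<Sum>i\<in>A. Poly_Mapping.single i (f i)) 1 :: ('v, 'a) mpoly)"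
    if "finite A" for A and f :: "'v \<Rightarrow> nat"
    using that by (induction A rule: finite_induct) (auto simp: pow mult_single)
  then show ?thesis
    by (simp add: mon_eval_def sum_single_lookup)
qed

lemma Const_mult_single:
  "Const c * Poly_Mapping.single m a = Poly_Mapping.single m (c * (a :: 'a::comm_ring_1))"
  by (simp add: Const_def mult_single)

lemma subst_Const_Var [simp]: "subst Const Var p = (p :: ('v, 'a::comm_ring_1) mpoly)"
  by (simp add: subst_eq_mon_eval mon_eval_Var Const_mult_single sum_single_lookup)

lemma subst_cong:
  assumes "p \<in> mpolys V" "\<And>i. i \<in> V \<Longrightarrow> \<sigma> i = \<sigma>' i"
  shows "subst h \<sigma> p = subst h \<sigma>' p"
  using assms unfolding subst_eq_mon_eval mon_eval_def mpolys_def
  by (intro sum.cong prod.cong arg_cong2[where f = "(*)"] arg_cong2[where f = "(^)"]) auto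

section \<open>Filtrations and degrees\<close>

text \<open>One interface for all size bounds. A constant family is a subring; other instances bound
  the total degree, a partial degree, or the degree in X, Y. Bounds on \<chi>, on determinants and
  on power series coefficients become instances of the same closure facts.\<close>

locale filtration =
  fixes F :: "nat \<Rightarrow> 'r::comm_ring_1 set"
  assumes zero_in: "0 \<in> F k"
    and one_in: "1 \<in> F k"
    and uminus_in: "a \<in> F k \<Longrightarrow> - a \<in> F k"
    and add_in: "a \<in> F k \<Longrightarrow> b \<in> F k \<Longrightarrow> a + b \<in> F k"
    and mult_in: "a \<in> F i \<Longrightarrow> b \<in> F j \<Longrightarrow> a * b \<in> F (i + j)"
    and mono_in: "i \<le> j \<Longrightarrow> F i \<subseteq> F j"
begin

lemma diff_in: "a \<in> F k \<Longrightarrow> b \<in> F k \<Longrightarrow> a - b \<in> F k"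
  using add_in[of a k "- b"] uminus_in[of b k] by simp

lemma sum_in: "(\<And>x. x \<in> A \<Longrightarrow> f x \<in> F k) \<Longrightarrow> sum f A \<in> F k"
  by (induction A rule: infinite_finite_induct) (auto intro: zero_in add_in)

lemma prod_in: "(\<And>x. x \<in> A \<Longrightarrow> f x \<in> F (g x)) \<Longrightarrow> prod f A \<in> F (sum g A)"
  by (induction A rule: infinite_finite_induct) (auto intro: one_in mult_in)

lemma power_in: "a \<in> F k \<Longrightarrow> a ^ j \<in> F (j * k)"
  by (induction j) (auto intro: one_in mult_in)

text \<open>A monomial of degree at most \<open>k\<close> is a product of at most \<open>k\<close>
  factors from \<open>F 1\<close>, and \<open>mono_in\<close> raises it to level
  \<open>k\<close>.\<close>

lemma subst_in:
  assumes h: "\<And>c. h c \<in> F 0" and \<sigma>: "\<And>i. i \<in> V \<Longrightarrow> \<sigma> i \<in> F 1"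
    and p: "p \<in> mpolys V" "total_degree p \<le> k"
  shows "subst h \<sigma> p \<in> F k"
  unfolding subst_def
proof (intro sum_in)
  fix m assume m: "m \<in> Poly_Mapping.keys p"
  let ?f = "Poly_Mapping.lookup m"
  have "monom_degree m \<le> k"
    using m p(2) by (auto simp: total_degree_def)
  have "(\<Prod>i\<in>Poly_Mapping.keys m. \<sigma> i ^ ?f i) \<in> F (\<Sum>i\<in>Poly_Mapping.keys m. ?f i)"
  proof (intro prod_in)
    fix i assume "i \<in> Poly_Mapping.keys m"
    then have "\<sigma> i \<in> F 1"
      using m p(1) \<sigma> by (auto simp: mpolys_def)
    then show "\<sigma> i ^ ?f i \<in> F (?f i)"
      using power_in[of "\<sigma> i" 1 "?f i"] by simp
  qed
  then have "(\<Prod>i\<in>Poly_Mapping.keys m. \<sigma> i ^ ?f i) \<in> F k"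
    using mono_in[of "monom_degree m" k] \<open>monom_degree m \<le> k\<close> by (auto simp: monom_degree_def)
  then show "h (Poly_Mapping.lookup p m) * (\<Prod>i\<in>Poly_Mapping.keys m. \<sigma> i ^ ?f i) \<in> F k"
    using mult_in[of _ 0 _ k] h by simp
qed

text \<open>Every Leibniz term takes exactly one entry from each row, so the row levels
  \<open>r i\<close> add up.\<close>

lemma det_in:
  assumes A: "A \<in> carrier_mat n n"
    and entry: "\<And>i j. i < n \<Longrightarrow> j < n \<Longrightarrow> A $$ (i, j) \<in> F (r i)"
  shows "det A \<in> F (\<Sum>i<n. r i)"
  unfolding det_def'[OF A]
proof (intro sum_in)
  fix p assume p: "p \<in> {p. p permutes {0..<n}}"
  have "(\<Prod>i = 0..<n. A $$ (i, p i)) \<in> F (\<Sum>i = 0..<n. r i)"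
  proof (intro prod_in entry)
    fix i assume "i \<in> {0..<n}"
    then show "i < n" "p i < n"
      using p permutes_in_image[of p "{0..<n}" i] by auto
  qed
  then have "(\<Prod>i = 0..<n. A $$ (i, p i)) \<in> F (\<Sum>i<n. r i)"
    by (simp add: atLeast0LessThan)
  then show "signof p * (\<Prod>i = 0..<n. A $$ (i, p i)) \<in> F (\<Sum>i<n. r i)"
    by (auto simp: sign_def intro: uminus_in)
qed

text \<open>Pulling back along a homomorphism turns a bound on an image, such as the degree of
  \<open>XY_graded p\<close>, into a filtration on the polynomials themselves.\<close>

lemma filtration_vimage:
  assumes "comm_ring_hom \<phi>"
  shows "filtration (\<lambda>k. {p. \<phi> p \<in> F k})"
proof -
  interpret h: comm_ring_hom \<phi> by fact
  show ?thesis
    by unfold_locales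
      (use mono_in in \<open>auto simp: h.hom_uminus h.hom_add h.hom_mult
        intro: zero_in one_in uminus_in add_in mult_in\<close>)
qed

lemma coeff_mult_in:
  assumes "\<And>j. j \<le> i \<Longrightarrow> Polynomial.coeff p j * Polynomial.coeff q (i - j) \<in> F k"
  shows "Polynomial.coeff (p * q) i \<in> F k"
  unfolding Polynomial.coeff_mult by (intro sum_in assms) auto

lemma filtration_coeffs:
  "filtration (\<lambda>k. {p. \<forall>i. Polynomial.coeff p i \<in> F k})"
proof
  fix a b i j assume "a \<in> {p. \<forall>l. Polynomial.coeff p l \<in> F i}"
    "b \<in> {p. \<forall>l. Polynomial.coeff p l \<in> F j}"
  then show "a * b \<in> {p. \<forall>l. Polynomial.coeff p l \<in> F (i + j)}"
    by (auto intro!: coeff_mult_in mult_in)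
qed (use mono_in in \<open>auto intro: zero_in one_in uminus_in add_in simp: coeff_1\<close>)

text \<open>The convolution pairs indices \<open>j\<close> and \<open>i - j\<close>, whose levels
  add to \<open>i\<close>. This subring holds the power series root, whose coefficient of Y^k has
  degree at most k in Z.\<close>

lemma filtration_graded_coeffs:
  "filtration (\<lambda>_. {p. \<forall>i. Polynomial.coeff p i \<in> F i})"
proof
  fix a b assume ab: "a \<in> {p. \<forall>l. Polynomial.coeff p l \<in> F l}"
    "b \<in> {p. \<forall>l. Polynomial.coeff p l \<in> F l}"
  have "Polynomial.coeff a j * Polynomial.coeff b (i - j) \<in> F i" if "j \<le> i" for i j
    using ab mult_in[of "Polynomial.coeff a j" j "Polynomial.coeff b (i - j)" "i - j"] that
    by simp
  then show "a * b \<in> {p. \<forall>l. Polynomial.coeff p l \<in> F l}"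
    by (auto intro!: coeff_mult_in)
qed (auto intro: zero_in one_in uminus_in add_in simp: coeff_1)

end

lemma filtration_degree: "filtration (\<lambda>k. {p. Polynomial.degree p \<le> k})"
  by unfold_locales (auto intro: degree_add_le order.trans[OF degree_mult_le])

lemma keys_add_nat: "Poly_Mapping.keys (m + m' :: 'v \<Rightarrow>\<^sub>0 nat) = Poly_Mapping.keys m \<union> Poly_Mapping.keys m'"
  by (auto simp: in_keys_iff lookup_add)

lemma monom_degree_superset:
  assumes "finite A" "Poly_Mapping.keys m \<subseteq> A"
  shows "monom_degree m = (\<Sum>i\<in>A. Poly_Mapping.lookup m i)"
  unfolding monom_degree_def using assms
  by (intro sum.mono_neutral_left) (auto simp: in_keys_iff)

lemma monom_degree_add: "monom_degree (m + m') = monom_degree m + monom_degree m'"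
  using monom_degree_superset[of "Poly_Mapping.keys m \<union> Poly_Mapping.keys m'"]
  by (simp add: keys_add_nat lookup_add sum.distrib)

lemma total_degree_le_iff:
  "total_degree p \<le> k \<longleftrightarrow> (\<forall>m\<in>Poly_Mapping.keys p. monom_degree m \<le> k)"
  by (auto simp: total_degree_def)

lemma filtration_mpolys_total_degree:
  "filtration (\<lambda>k. {p :: ('v, 'a::comm_ring_1) mpoly. p \<in> mpolys V \<and> total_degree p \<le> k})"
proof (unfold_locales, goal_cases)
  case (3 a k)
  have "Poly_Mapping.keys (- a) = Poly_Mapping.keys a"
    by (auto simp: in_keys_iff)
  with 3 show ?case by (simp add: mpolys_def total_degree_le_iff)
next
  case (4 a k b)
  then show ?case
    using Poly_Mapping.keys_add[of a b] unfolding mpolys_def total_degree_le_iff by blast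
next
  case (5 a i b j)
  show ?case
    unfolding mpolys_def total_degree_le_iff mem_Collect_eq
  proof (intro conjI ballI)
    fix m assume "m \<in> Poly_Mapping.keys (a * b)"
    then obtain m1 m2 where m: "m = m1 + m2" "m1 \<in> Poly_Mapping.keys a" "m2 \<in> Poly_Mapping.keys b"
      using keys_mult[of a b] by auto
    then show "Poly_Mapping.keys m \<subseteq> V"
      using 5 by (auto simp: keys_add_nat mpolys_def)
    have "monom_degree m1 \<le> i" "monom_degree m2 \<le> j"
      using 5 m by (auto simp: total_degree_le_iff)
    then show "monom_degree m \<le> i + j"
      using m by (simp add: monom_degree_add)
  qed
qed (auto simp: mpolys_def total_degree_le_iff monom_degree_def)

text \<open>The subring is the union of its degree levels, so closure is read off at a level large
  enough for the elements at hand.\<close>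

lemma filtration_mpolys: "filtration (\<lambda>_. mpolys V :: ('v, 'a::comm_ring_1) mpoly set)"
proof -
  interpret filtration "\<lambda>k. {p :: ('v, 'a) mpoly. p \<in> mpolys V \<and> total_degree p \<le> k}"
    by (rule filtration_mpolys_total_degree)
  show ?thesis
  proof
    fix a b :: "('v, 'a) mpoly" assume ab: "a \<in> mpolys V" "b \<in> mpolys V"
    show "a + b \<in> mpolys V"
      using add_in[of a "max (total_degree a) (total_degree b)" b] ab by auto
    show "a * b \<in> mpolys V"
      using mult_in[of a "total_degree a" b "total_degree b"] ab by auto
  next
    fix a :: "('v, 'a) mpoly" assume "a \<in> mpolys V"
    then show "- a \<in> mpolys V"
      using uminus_in[of a "total_degree a"] by auto
  qed (use zero_in one_in in auto)
qed

lemma Const_in_mpolys [simp]: "Const c \<in> mpolys V"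
  by (auto simp: mpolys_def Const_def)

lemma Var_in_mpolys [simp]: "Var i \<in> mpolys V \<longleftrightarrow> i \<in> V"
  by (auto simp: mpolys_def Var_def)

lemma mpolys_mono: "V \<subseteq> W \<Longrightarrow> p \<in> mpolys V \<Longrightarrow> p \<in> mpolys W"
  by (auto simp: mpolys_def)

lemma total_degree_Const [simp]: "total_degree (Const c) = 0"
  by (simp add: total_degree_def Const_def monom_degree_def)

lemma total_degree_Var: "total_degree (Var i :: ('v, 'a::comm_ring_1) mpoly) = 1"
  by (simp add: total_degree_def Var_def monom_degree_def)

lemma mpolys_empty:
  assumes "p \<in> mpolys {}"
  obtains c where "p = Const c"
proof
  have *: "m = 0" if "m \<in> Poly_Mapping.keys p" for m
    using assms that by (auto simp: mpolys_def)
  show "p = Const (Poly_Mapping.lookup p 0)"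
  proof (rule poly_mapping_eqI)
    fix m show "Poly_Mapping.lookup p m = Poly_Mapping.lookup (Const (Poly_Mapping.lookup p 0)) m"
      using *[of m] by (cases "m = 0") (auto simp: Const_def lookup_single when_def in_keys_iff)
  qed
qed

lemma mpolys_finite:
  obtains V where "finite V" "p \<in> mpolys V"
proof
  show "finite (\<Union>m\<in>Poly_Mapping.keys p. Poly_Mapping.keys m)"
    by auto
qed (auto simp: mpolys_def)

section \<open>Partial degrees and factorization inside polynomial subrings\<close>

lemma comm_ring_hom_Const_pCons: "comm_ring_hom (\<lambda>c. [:Const c:])"
  by (rule comm_ring_hom_comp[OF comm_ring_hom_pCons_0 comm_ring_hom_Const])

lemma comm_ring_hom_as_poly_in: "comm_ring_hom (as_poly_in x)"
  using comm_ring_hom_subst[OF comm_ring_hom_Const_pCons] by (simp add: as_poly_in_def[abs_def])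

lemma as_poly_in_0 [simp]: "as_poly_in x 0 = 0"
  and as_poly_in_1 [simp]: "as_poly_in x 1 = 1"
  and as_poly_in_add: "as_poly_in x (p + q) = as_poly_in x p + as_poly_in x q"
  and as_poly_in_mult: "as_poly_in x (p * q) = as_poly_in x p * as_poly_in x q"
proof -
  interpret comm_ring_hom "as_poly_in x" by (rule comm_ring_hom_as_poly_in)
  show "as_poly_in x 0 = 0" "as_poly_in x 1 = 1"
    "as_poly_in x (p + q) = as_poly_in x p + as_poly_in x q"
    "as_poly_in x (p * q) = as_poly_in x p * as_poly_in x q"
    by (simp_all add: hom_add hom_mult)
qed

text \<open>The composite fixes all constants and indeterminates. Hence \<open>as_poly_in x\<close>
  is injective with an explicit left inverse.\<close>

lemma poly_as_poly_in [simp]: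
  fixes p :: "('v, 'a::comm_ring_1) mpoly"
  shows "poly (as_poly_in x p) (Var x) = p"
proof -
  have "poly (as_poly_in x p) (Var x) =
      subst (\<lambda>c. poly [:Const c:] (Var x)) (\<lambda>i. poly (if i = x then [:0, 1:] else [:Var i:]) (Var x)) p"
    unfolding as_poly_in_def by (rule hom_subst[OF comm_ring_hom_poly])
  also have "(\<lambda>i. poly (if i = x then [:0, 1:] else [:Var i:]) (Var x)) = (Var :: 'v \<Rightarrow> ('v, 'a) mpoly)"
    by (rule ext) auto
  finally show ?thesis by simp
qed

lemma as_poly_in_inj: "as_poly_in x p = as_poly_in x q \<Longrightarrow> p = q"
  by (metis poly_as_poly_in)

lemma as_poly_in_eq_0_iff [simp]: "as_poly_in x p = 0 \<longleftrightarrow> p = 0"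
  using as_poly_in_inj[of x p 0] by auto

lemma as_poly_in_Const [simp]: "as_poly_in x (Const c) = [:Const c:]"
  unfolding as_poly_in_def by (rule subst_Const[OF comm_ring_hom_Const_pCons])

lemma as_poly_in_Var: "as_poly_in x (Var i) = (if i = x then [:0, 1:] else [:Var i:])"
  unfolding as_poly_in_def by (rule subst_Var[OF comm_ring_hom_Const_pCons])

lemma as_poly_in_free:
  assumes "p \<in> mpolys V" "x \<notin> V"
  shows "as_poly_in x p = [:p:]"
proof -
  have "as_poly_in x p = subst (\<lambda>c. [:Const c:]) (\<lambda>i. [:Var i:]) p"
    unfolding as_poly_in_def using assms by (intro subst_cong[of p V]) auto
  also have "\<dots> = [:subst Const Var p:]"
    by (rule hom_subst[OF comm_ring_hom_pCons_0, symmetric])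
  finally show ?thesis by simp
qed

lemma coeff_as_poly_in_mpolys:
  assumes "p \<in> mpolys V"
  shows "Polynomial.coeff (as_poly_in x p) k \<in> mpolys (V - {x})"
proof -
  interpret filtration "\<lambda>_. mpolys (V - {x})" by (rule filtration_mpolys)
  interpret c: filtration "\<lambda>_. {p. \<forall>i. Polynomial.coeff p i \<in> mpolys (V - {x})}"
    by (rule filtration_coeffs)
  have "as_poly_in x p \<in> {p. \<forall>i. Polynomial.coeff p i \<in> mpolys (V - {x})}"
    unfolding as_poly_in_def
    by (rule c.subst_in[OF _ _ assms order.refl])
      (auto simp: coeff_pCons zero_in one_in split: nat.splits)
  then show ?thesis by auto
qed

text \<open>The coefficients must be free of \<open>x\<close>: occurrences of \<open>x\<close> in
  them would be moved into the powers of the main variable.\<close>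

lemma as_poly_in_poly:
  assumes "\<And>i. Polynomial.coeff P i \<in> mpolys V" "x \<notin> V"
  shows "as_poly_in x (poly P (Var x)) = P"
  using assms(1)
proof (induction P)
  case (pCons a P)
  have a: "a \<in> mpolys V"
    using pCons.prems[of 0] by simp
  have "Polynomial.coeff P i \<in> mpolys V" for i
    using pCons.prems[of "Suc i"] by simp
  then have "as_poly_in x (poly P (Var x)) = P"
    by (rule pCons.IH)
  then show ?case
    by (simp add: as_poly_in_add as_poly_in_mult as_poly_in_free[OF a assms(2)] as_poly_in_Var)
qed auto

definition deg_in :: "'v \<Rightarrow> ('v, 'a::comm_ring_1) mpoly \<Rightarrow> nat" where
  "deg_in x p = Polynomial.degree (as_poly_in x p)"

lemma filtration_deg_in: "filtration (\<lambda>k. {p. deg_in x p \<le> k})"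
  using filtration.filtration_vimage[OF filtration_degree comm_ring_hom_as_poly_in]
  by (simp add: deg_in_def)

text \<open>A linear order on the indeterminates makes the polynomials an integral domain, so
  leading coefficients in \<open>x\<close> multiply to a nonzero one.\<close>

lemma deg_in_mult:
  fixes p q :: "('v::linorder, 'a::idom) mpoly"
  assumes "p \<noteq> 0" "q \<noteq> 0"
  shows "deg_in x (p * q) = deg_in x p + deg_in x q"
  using assms by (simp add: deg_in_def as_poly_in_mult degree_mult_eq)

lemma deg_in_eq_0_iff:
  assumes "p \<in> mpolys (insert x V)" "x \<notin> V"
  shows "deg_in x p = 0 \<longleftrightarrow> p \<in> mpolys V"
proof
  assume "deg_in x p = 0"
  then obtain c where c: "as_poly_in x p = [:c:]"
    unfolding deg_in_def by (rule degree_eq_zeroE)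
  have "p = c"
    using poly_as_poly_in[of x p] c by simp
  moreover have "c \<in> mpolys (insert x V - {x})"
    using coeff_as_poly_in_mpolys[OF assms(1), of x 0] c by simp
  ultimately show "p \<in> mpolys V"
    using assms(2) by simp
qed (auto simp: deg_in_def as_poly_in_free[OF _ assms(2)])

text \<open>Expresses membership in a subring through vanishing partial degrees, which are additive
  on products of nonzero polynomials and so pass to factors.\<close>

lemma mpolys_iff_deg_in: "p \<in> mpolys V \<longleftrightarrow> (\<forall>x. x \<notin> V \<longrightarrow> deg_in x p = 0)"
proof (intro iffI allI impI)
  fix x assume "p \<in> mpolys V" "x \<notin> V"
  then show "deg_in x p = 0"
    using deg_in_eq_0_iff[of p x V] mpolys_mono[of V "insert x V" p] by auto
next
  assume *: "\<forall>x. x \<notin> V \<longrightarrow> deg_in x p = 0"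
  show "p \<in> mpolys V"
  proof (rule ccontr)
    assume "p \<notin> mpolys V"
    then obtain m x where mx: "m \<in> Poly_Mapping.keys p" "x \<in> Poly_Mapping.keys m" "x \<notin> V"
      by (auto simp: mpolys_def)
    have "p \<in> mpolys (- {x})"
      using * mx(3) deg_in_eq_0_iff[of p x "- {x}"] by (auto simp: mpolys_def)
    with mx show False by (auto simp: mpolys_def)
  qed
qed

lemma mult_in_mpolysD:
  fixes p q :: "('v::linorder, 'a::idom) mpoly"
  assumes "p * q \<in> mpolys V" "p * q \<noteq> 0"
  shows "p \<in> mpolys V" "q \<in> mpolys V"
  using assms by (auto simp: mpolys_iff_deg_in deg_in_mult)

lemma Const_dvd_1: "c \<noteq> 0 \<Longrightarrow> Const (c :: 'a::field) dvd 1"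
  by (rule dvdI[of _ _ "Const (inverse c)"]) (simp add: Const_def mult_single)

lemma dvd_1_Const:
  fixes p :: "('v::linorder, 'a::idom) mpoly"
  assumes "p dvd 1"
  obtains c where "p = Const c" "c \<noteq> 0"
proof -
  from assms obtain q where q: "1 = p * q" ..
  have "1 \<in> (mpolys {} :: ('v, 'a) mpoly set)"
    by (simp add: mpolys_def)
  then have "p \<in> mpolys {}"
    using mult_in_mpolysD(1)[of p q "{}"] q by simp
  then obtain c where "p = Const c"
    by (rule mpolys_empty)
  with q show ?thesis
    using that by fastforce
qed

text \<open>Factors of a nonzero element of \<open>mpolys V\<close>, and inverses of its units,
  again lie in \<open>mpolys V\<close>. So irreducibility carries over to the whole ring, where the
  type class notions apply.\<close>

lemma irreducible_in_imp_irreducible: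
  fixes p :: "('v::linorder, 'a::idom) mpoly"
  assumes "irreducible_in (mpolys V) p"
  shows "irreducible p"
proof (rule irreducibleI)
  show "p \<noteq> 0"
    using assms by (simp add: irreducible_in_def)
  have p: "p \<in> mpolys V"
    using assms by (simp add: irreducible_in_def)
  have unit: "dvd_in (mpolys V) a 1" if "a dvd 1" for a :: "('v, 'a) mpoly"
  proof -
    from that obtain b where b: "1 = a * b" ..
    have "1 \<in> (mpolys V :: ('v, 'a) mpoly set)"
      by (simp add: mpolys_def)
    then have "b \<in> mpolys V"
      using mult_in_mpolysD(2)[of a b V] b by simp
    with b show ?thesis by (auto simp: dvd_in_def)
  qed
  then show "\<not> p dvd 1"
    using assms by (auto simp: irreducible_in_def)
  fix a b assume ab: "p = a * b"
  have "a \<in> mpolys V" "b \<in> mpolys V"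
    using mult_in_mpolysD[of a b V] p \<open>p \<noteq> 0\<close> ab by auto
  then have "dvd_in (mpolys V) a 1 \<or> dvd_in (mpolys V) b 1"
    using assms ab by (auto simp: irreducible_in_def)
  then show "a dvd 1 \<or> b dvd 1"
    unfolding dvd_in_def by (metis dvd_triv_left)
qed

section \<open>Irreducible polynomials are prime\<close>

lemma dvd_as_poly_in_iff:
  assumes "c \<in> mpolys V" "x \<notin> V"
  shows "c dvd p \<longleftrightarrow> (\<forall>k. c dvd Polynomial.coeff (as_poly_in x p) k)"
proof
  assume "c dvd p"
  then obtain q where "p = c * q" ..
  then have "as_poly_in x p = smult c (as_poly_in x q)"
    by (simp add: as_poly_in_mult as_poly_in_free[OF assms])
  then show "\<forall>k. c dvd Polynomial.coeff (as_poly_in x p) k"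
    by simp
next
  assume *: "\<forall>k. c dvd Polynomial.coeff (as_poly_in x p) k"
  have "p = (\<Sum>i\<le>Polynomial.degree (as_poly_in x p). Polynomial.coeff (as_poly_in x p) i * Var x ^ i)"
    using poly_as_poly_in[of x p] by (simp add: poly_altdef)
  moreover have "c dvd \<dots>"
    using * by (intro dvd_sum dvd_mult2) auto
  ultimately show "c dvd p" by simp
qed

text \<open>Gauss's argument: let i and j be the first indices at which the coefficients of
  \<open>g\<close> and \<open>h\<close> are not divisible by \<open>c\<close>. Modulo
  \<open>c\<close>, the coefficient of the product at i + j is the product of these two
  coefficients.\<close>

lemma prime_lift:
  fixes c g h :: "('v::linorder, 'a::field) mpoly"
  assumes c: "c \<in> mpolys V" and x: "x \<notin> V"
    and prime: "\<And>a b. a \<in> mpolys V \<Longrightarrow> b \<in> mpolys V \<Longrightarrow> c dvd a * b \<Longrightarrow> c dvd a \<or> c dvd b"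
    and gh: "g \<in> mpolys (insert x V)" "h \<in> mpolys (insert x V)" "c dvd g * h"
  shows "c dvd g \<or> c dvd h"
proof (rule ccontr)
  let ?G = "Polynomial.coeff (as_poly_in x g)" and ?H = "Polynomial.coeff (as_poly_in x h)"
  assume "\<not> ?thesis"
  then have ex: "\<exists>i. \<not> c dvd ?G i" "\<exists>i. \<not> c dvd ?H i"
    using dvd_as_poly_in_iff[OF c x, of g] dvd_as_poly_in_iff[OF c x, of h] by auto
  define i j where "i = (LEAST i. \<not> c dvd ?G i)" and "j = (LEAST i. \<not> c dvd ?H i)"
  have i: "\<not> c dvd ?G i" and j: "\<not> c dvd ?H j"
    unfolding i_def j_def by (rule LeastI_ex[OF ex(1)], rule LeastI_ex[OF ex(2)])
  have less_i: "c dvd ?G k" if "k < i" for k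
    using not_less_Least[of k "\<lambda>i. \<not> c dvd ?G i"] that by (auto simp: i_def)
  have less_j: "c dvd ?H k" if "k < j" for k
    using not_less_Least[of k "\<lambda>i. \<not> c dvd ?H i"] that by (auto simp: j_def)
  have "c dvd Polynomial.coeff (as_poly_in x (g * h)) (i + j)"
    using gh(3) dvd_as_poly_in_iff[OF c x, of "g * h"] by blast
  also have "Polynomial.coeff (as_poly_in x (g * h)) (i + j) = (\<Sum>k\<le>i + j. ?G k * ?H (i + j - k))"
    by (simp add: as_poly_in_mult Polynomial.coeff_mult)
  also have "\<dots> = ?G i * ?H j + (\<Sum>k\<in>{..i + j} - {i}. ?G k * ?H (i + j - k))"
    by (subst sum.remove[of _ i]) auto
  finally have "c dvd ?G i * ?H j + (\<Sum>k\<in>{..i + j} - {i}. ?G k * ?H (i + j - k))" .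
  \<comment> \<open>Every other index pair with sum i + j has one index below its minimum.\<close>
  moreover have rest: "c dvd (\<Sum>k\<in>{..i + j} - {i}. ?G k * ?H (i + j - k))"
  proof (intro dvd_sum)
    fix k assume "k \<in> {..i + j} - {i}"
    then have "k < i \<or> i + j - k < j" by auto
    then show "c dvd ?G k * ?H (i + j - k)"
      using less_i less_j by auto
  qed
  ultimately have "c dvd ?G i * ?H j"
    using dvd_add_left_iff[OF rest] by simp
  moreover have "?G i \<in> mpolys V" "?H j \<in> mpolys V"
    using coeff_as_poly_in_mpolys[OF gh(1), of x i] coeff_as_poly_in_mpolys[OF gh(2), of x j] x
    by simp_all
  ultimately show False
    using prime i j by blast
qed

text \<open>Division over the fraction field with denominators cleared: \<open>c\<close> is a power
  of the leading coefficient of \<open>r\<close> in \<open>x\<close>, hence free of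
  \<open>x\<close>.\<close>

lemma pseudo_division:
  fixes p r :: "('v::linorder, 'a::field) mpoly"
  assumes x: "x \<notin> V" and r: "r \<in> mpolys (insert x V)" "r \<noteq> 0"
    and p: "p \<in> mpolys (insert x V)"
  obtains c q s where "c \<in> mpolys V" "c \<noteq> 0" "q \<in> mpolys (insert x V)"
    "c * p = q * r + s" "s = 0 \<or> deg_in x s < deg_in x r"
proof -
  interpret V: filtration "\<lambda>_. mpolys V :: ('v, 'a) mpoly set" by (rule filtration_mpolys)
  interpret C: filtration "\<lambda>_. mpolys (insert x V) :: ('v, 'a) mpoly set" by (rule filtration_mpolys)
  define lc where "lc p = Polynomial.lead_coeff (as_poly_in x p)" for p :: "('v, 'a) mpoly"
  have lc: "lc p \<in> mpolys V" if "p \<in> mpolys (insert x V)" for p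
    using coeff_as_poly_in_mpolys[OF that, of x] x by (simp add: lc_def)
  have sub: "p \<in> mpolys (insert x V)" if "p \<in> mpolys V" for p :: "('v, 'a) mpoly"
    using mpolys_mono[of V "insert x V" p] that by auto
  have "\<exists>c q s. c \<in> mpolys V \<and> c \<noteq> 0 \<and> q \<in> mpolys (insert x V) \<and>
    c * p = q * r + s \<and> (s = 0 \<or> deg_in x s < deg_in x r)"
    using p
  proof (induction "deg_in x p" arbitrary: p rule: less_induct)
    case less
    show ?case
    proof (cases "p = 0 \<or> deg_in x p < deg_in x r")
      case True
      then show ?thesis
        using V.one_in C.zero_in by (intro exI[of _ 1] exI[of _ 0] exI[of _ p]) auto
    next
      case False
      define k where "k = deg_in x p - deg_in x r"
      define t where "t = lc p * Var x ^ k"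
      \<comment> \<open>The multiple \<open>t * r\<close> is shifted and scaled so that the leading
        terms in \<open>x\<close> cancel.\<close>
      define p' where "p' = lc r * p - t * r"
      have t: "t \<in> mpolys (insert x V)"
        unfolding t_def using C.mult_in sub lc less.prems C.power_in[of "Var x"] by auto
      have p': "p' \<in> mpolys (insert x V)"
        unfolding p'_def using C.mult_in C.diff_in sub lc r(1) less.prems t by auto
      have lcr: "lc r \<noteq> 0"
        using r(2) by (simp add: lc_def)
      let ?P = "as_poly_in x p" and ?R = "as_poly_in x r"
      have P': "as_poly_in x p' = smult (lc r) ?P - Polynomial.monom (lc p) k * ?R"
      proof -
        interpret h: comm_ring_hom "as_poly_in x" by (rule comm_ring_hom_as_poly_in)
        have "as_poly_in x t = Polynomial.monom (lc p) k"
          using as_poly_in_free[OF lc[OF less.prems] x]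
          by (simp add: t_def h.hom_mult h.hom_power as_poly_in_Var monom_altdef)
        then show ?thesis
          using as_poly_in_free[OF lc[OF r(1)] x]
          by (simp add: p'_def h.hom_minus h.hom_mult)
      qed
      \<comment> \<open>When both degrees in \<open>x\<close> are 0, no smaller degree exists, but
        then \<open>p'\<close> is zero.\<close>
      have "p' = 0 \<or> deg_in x p' < deg_in x p"
      proof (cases "deg_in x p = 0")
        case True
        then obtain a b where "?P = [:a:]" "?R = [:b:]" "k = 0"
          using False by (auto simp: deg_in_def k_def elim!: degree_eq_zeroE)
        then have "as_poly_in x p' = 0"
          using P' by (simp add: lc_def monom_0)
        then show ?thesis by simp
      next
        case pos: False
        have "Polynomial.degree (as_poly_in x p') \<le> deg_in x p"
          unfolding P' using False
          by (intro degree_diff_le order.trans[OF degree_mult_le] order.trans[OF degree_smult_le]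
              order.trans[OF add_mono[OF degree_monom_le order.refl]])
            (auto simp: k_def deg_in_def)
        moreover have "Polynomial.coeff (as_poly_in x p') (deg_in x p) = 0"
        proof -
          have "Polynomial.coeff (Polynomial.monom (lc p) k * ?R) (k + deg_in x r) = lc p * lc r"
            by (simp add: coeff_monom_mult lc_def deg_in_def)
          moreover have "k + deg_in x r = deg_in x p"
            using False by (simp add: k_def)
          ultimately show ?thesis
            by (simp add: P' lc_def deg_in_def)
        qed
        ultimately show ?thesis
          using pos unfolding deg_in_def
          by (metis as_poly_in_eq_0_iff le_neq_implies_less leading_coeff_0_iff)
      qed
      then show ?thesis
      proof
        assume "p' = 0"
        then show ?thesis
          using lc[OF r(1)] lcr t by (intro exI[of _ "lc r"] exI[of _ t] exI[of _ 0]) (auto simp: p'_def)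
      next
        assume "deg_in x p' < deg_in x p"
        then obtain c q s where IH: "c \<in> mpolys V" "c \<noteq> 0" "q \<in> mpolys (insert x V)"
          "c * p' = q * r + s" "s = 0 \<or> deg_in x s < deg_in x r"
          using less.hyps p' by blast
        have "c * lc r * p = (q + c * t) * r + s"
          using IH(4) by (simp add: p'_def algebra_simps)
        moreover have "c * lc r \<in> mpolys V" "q + c * t \<in> mpolys (insert x V)"
          using IH lc[OF r(1)] V.mult_in C.mult_in C.add_in t sub by auto
        ultimately show ?thesis
          using IH lcr by (intro exI[of _ "c * lc r"] exI[of _ "q + c * t"] exI[of _ s]) auto
      qed
    qed
  qed
  then show ?thesis using that by blast
qed

text \<open>The sum of the partial degrees drops strictly when a nonunit factor is split off: only
  constants have sum zero, and nonzero constants are units.\<close>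

lemma irreducible_factor_exists:
  fixes p :: "('v::linorder, 'a::field) mpoly"
  assumes "p \<noteq> 0" "\<not> p dvd 1"
  obtains q where "irreducible q" "q dvd p"
proof -
  obtain V where V: "finite V" "p \<in> mpolys V"
    by (rule mpolys_finite)
  have "\<exists>q. irreducible q \<and> q dvd p"
    using assms V(2)
  proof (induction "\<Sum>x\<in>V. deg_in x p" arbitrary: p rule: less_induct)
    case less
    show ?case
    proof (cases "irreducible p")
      case False
      then obtain a b where ab: "p = a * b" "\<not> a dvd 1" "\<not> b dvd 1"
        using less.prems by (auto simp: irreducible_def)
      have nz: "a \<noteq> 0" "b \<noteq> 0"
        using ab less.prems by auto
      have in_V: "a \<in> mpolys V" "b \<in> mpolys V"
        using mult_in_mpolysD[of a b V] less.prems ab by auto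
      have "(\<Sum>x\<in>V. deg_in x b) \<noteq> 0"
      proof
        assume "(\<Sum>x\<in>V. deg_in x b) = 0"
        then have "deg_in x b = 0" for x
          using V(1) in_V(2) by (cases "x \<in> V") (auto simp: mpolys_iff_deg_in)
        then have "b \<in> mpolys {}"
          by (simp add: mpolys_iff_deg_in)
        then obtain c where "b = Const c"
          by (rule mpolys_empty)
        then show False
          using ab(3) nz Const_dvd_1[of c] by auto
      qed
      then have "(\<Sum>x\<in>V. deg_in x a) < (\<Sum>x\<in>V. deg_in x p)"
        using nz by (simp add: ab deg_in_mult sum.distrib)
      then show ?thesis
        using less.hyps[of a] nz ab in_V by auto
    qed auto
  qed
  then show ?thesis using that by blast
qed

text \<open>Irreducible factors of \<open>c\<close> are peeled off one at a time; each is prime for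
  products from \<open>mpolys W\<close> and so goes to \<open>r\<close> or to \<open>q\<close>. This
  cancels the denominators left by pseudo-division.\<close>

lemma mult_eq_split:
  fixes c u r q :: "('v::linorder, 'a::field) mpoly"
  assumes V: "\<And>\<pi> a b :: ('v, 'a) mpoly. \<pi> \<in> mpolys V \<Longrightarrow> irreducible \<pi> \<Longrightarrow> a \<in> mpolys W \<Longrightarrow> b \<in> mpolys W \<Longrightarrow>
      \<pi> dvd a * b \<Longrightarrow> \<pi> dvd a \<or> \<pi> dvd b"
    and c: "c \<in> mpolys V" "c \<noteq> 0" and rq: "r \<in> mpolys W" "q \<in> mpolys W"
    and eq: "c * u = r * q"
  obtains c1 c2 r' q' where "c = c1 * c2" "r = c1 * r'" "q = c2 * q'" "u = r' * q'"
proof -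
  obtain T where T: "finite T" "c \<in> mpolys T"
    by (rule mpolys_finite)
  have "\<exists>c1 c2 r' q'. c = c1 * c2 \<and> r = c1 * r' \<and> q = c2 * q' \<and> u = r' * q'"
    using c rq eq T(2)
  proof (induction "\<Sum>x\<in>T. deg_in x c" arbitrary: c r q rule: less_induct)
    case less
    show ?case
    proof (cases "c dvd 1")
      case True
      then obtain d where d: "1 = c * d" ..
      have "r = c * (d * r)"
        using d by (metis mult.assoc mult_1)
      moreover have "u = d * r * q"
        using less.prems(5) d by (metis mult.assoc mult.commute mult_1)
      ultimately show ?thesis
        by (intro exI[of _ c] exI[of _ 1] exI[of _ "d * r"] exI[of _ q]) auto
    next
      case False
      then obtain \<pi> where \<pi>: "irreducible \<pi>" "\<pi> dvd c"
        using irreducible_factor_exists[of c] less.prems by blast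
      then obtain c' where c': "c = \<pi> * c'" by auto
      have nz: "\<pi> \<noteq> 0" "c' \<noteq> 0"
        using less.prems c' by auto
      have in_V: "\<pi> \<in> mpolys V" "c' \<in> mpolys V" "\<pi> \<in> mpolys T" "c' \<in> mpolys T"
        using mult_in_mpolysD[of \<pi> c'] less.prems c' by auto
      have "(\<Sum>x\<in>T. deg_in x \<pi>) \<noteq> 0"
      proof
        assume "(\<Sum>x\<in>T. deg_in x \<pi>) = 0"
        then have "deg_in x \<pi> = 0" for x
          using T(1) in_V(3) by (cases "x \<in> T") (auto simp: mpolys_iff_deg_in)
        then have "\<pi> \<in> mpolys {}"
          by (simp add: mpolys_iff_deg_in)
        then obtain a where "\<pi> = Const a"
          by (rule mpolys_empty)
        then show False
          using \<pi>(1) nz Const_dvd_1[of a] by (auto simp: irreducible_def)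
      qed
      then have smaller: "(\<Sum>x\<in>T. deg_in x c') < (\<Sum>x\<in>T. deg_in x c)"
        using nz by (simp add: c' deg_in_mult sum.distrib)
      have "\<pi> dvd r * q"
        using less.prems(5) c' by (metis dvd_triv_left mult.assoc)
      then have "\<pi> dvd r \<or> \<pi> dvd q"
        by (rule V[OF in_V(1) \<pi>(1) less.prems(3,4)])
      then show ?thesis
      proof
        assume "\<pi> dvd r"
        then obtain r1 where r1: "r = \<pi> * r1" ..
        have "r1 \<in> mpolys W"
        proof (cases "r = 0")
          case True
          then show ?thesis using r1 nz by (simp add: mpolys_def)
        next
          case False
          then show ?thesis using r1 mult_in_mpolysD(2)[of \<pi> r1 W] less.prems by auto
        qed
        moreover have "c' * u = r1 * q"
          using less.prems(5) c' r1 nz by (simp add: mult.assoc)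
        ultimately obtain c1 c2 r' q' where "c' = c1 * c2" "r1 = c1 * r'" "q = c2 * q'" "u = r' * q'"
          using less.hyps[OF smaller, of r1 q] in_V nz less.prems by blast
        then show ?thesis
          using c' r1 by (intro exI[of _ "\<pi> * c1"] exI[of _ c2] exI[of _ r'] exI[of _ q']) auto
      next
        assume "\<pi> dvd q"
        then obtain q1 where q1: "q = \<pi> * q1" ..
        have "q1 \<in> mpolys W"
        proof (cases "q = 0")
          case True
          then show ?thesis using q1 nz by (simp add: mpolys_def)
        next
          case False
          then show ?thesis using q1 mult_in_mpolysD(2)[of \<pi> q1 W] less.prems by auto
        qed
        moreover have "c' * u = r * q1"
          using less.prems(5) c' q1 nz by (simp add: mult.left_commute)
        ultimately obtain c1 c2 r' q' where "c' = c1 * c2" "r = c1 * r'" "q1 = c2 * q'" "u = r' * q'"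
          using less.hyps[OF smaller, of r q1] in_V nz less.prems by blast
        then show ?thesis
          using c' q1 by (intro exI[of _ c1] exI[of _ "\<pi> * c2"] exI[of _ r'] exI[of _ q']) auto
      qed
    qed
  qed
  then show ?thesis using that by blast
qed

text \<open>Induction on the indeterminates, as in Gauss's theorem that polynomial rings over
  factorial rings are factorial. For \<open>f\<close> free of \<open>x\<close>, primality is lifted
  coefficientwise; for other \<open>f\<close>, a Euclidean argument in \<open>x\<close> works over
  the fraction field with denominators cleared.\<close>

lemma irreducible_imp_prime_mpolys:
  fixes f g h :: "('v::linorder, 'a::field) mpoly"
  assumes "finite V" "f \<in> mpolys V" "irreducible f" "g \<in> mpolys V" "h \<in> mpolys V" "f dvd g * h"
  shows "f dvd g \<or> f dvd h"
  using assms
proof (induction V arbitrary: f g h rule: finite_induct)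
  case empty
  then obtain c where "f = Const c"
    using mpolys_empty by blast
  then show ?case
    using \<open>irreducible f\<close> Const_dvd_1[of c] by (auto simp: irreducible_def)
next
  case (insert x V)
  let ?C = "mpolys (insert x V) :: ('v, 'a) mpoly set"
  interpret C: filtration "\<lambda>_. ?C" by (rule filtration_mpolys)
  have sub: "p \<in> ?C" if "p \<in> mpolys V" for p
    using mpolys_mono[of V "insert x V" p] that by auto
  have lift: "\<pi> dvd a \<or> \<pi> dvd b"
    if "\<pi> \<in> mpolys V" "irreducible \<pi>" "a \<in> ?C" "b \<in> ?C" "\<pi> dvd a * b" for \<pi> a b
    by (rule prime_lift[OF that(1) insert.hyps(2) _ that(3-5)]) (rule insert.IH[OF that(1,2)])
  note split = mult_eq_split[of V "insert x V", OF lift]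
  show ?case
  proof (cases "f \<in> mpolys V")
    case True
    then show ?thesis using lift insert.prems by blast
  next
    case False
    note not_V = False
    have f: "f \<noteq> 0"
      using insert.prems by auto
    \<comment> \<open>Splitting \<open>c * p = f * s\<close> gives \<open>f = c1 * f'\<close> with
      \<open>c1\<close> free of \<open>x\<close>, and one factor is a unit. It is \<open>c1\<close>,
      since otherwise \<open>f\<close> would be free of \<open>x\<close>.\<close>
    have cancel: "f dvd p" if c: "c \<in> mpolys V" "c \<noteq> 0" and p: "p \<in> ?C" "f dvd c * p" for c p
    proof (cases "p = 0")
      case False
      from p(2) obtain s where s: "c * p = f * s" ..
      have "c * p \<in> ?C"
        using C.mult_in sub c p by blast
      moreover have "c * p \<noteq> 0"
        using False c by simp
      ultimately have "s \<in> ?C"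
        unfolding s by (rule mult_in_mpolysD)
      from split[OF _ _ _ _ _ c insert.prems(1) this s]
      obtain c1 c2 f' s' where *: "c = c1 * c2" "f = c1 * f'" "s = c2 * s'" "p = f' * s'"
        by blast
      have "c1 \<in> mpolys V"
        using * c mult_in_mpolysD(1)[of c1 c2 V] by auto
      from insert.prems(2) *(2) have "c1 dvd 1 \<or> f' dvd 1"
        by (auto simp: irreducible_def)
      then show ?thesis
      proof
        assume "c1 dvd 1"
        then obtain d where d: "1 = c1 * d" ..
        have "f * d = f' * (c1 * d)"
          using *(2) by (simp add: ac_simps)
        then have "p = f * (d * s')"
          using *(4) d by (simp flip: mult.assoc)
        then show ?thesis by simp
      next
        assume "f' dvd 1"
        then obtain d where "f' = Const d"
          by (rule dvd_1_Const)
        then have "f \<in> mpolys V"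
          using * \<open>c1 \<in> mpolys V\<close> filtration.mult_in[OF filtration_mpolys, of c1 V f'] by auto
        with not_V show ?thesis by simp
      qed
    qed auto
    \<comment> \<open>A nonzero element \<open>r\<close> of least degree in \<open>x\<close> plays the role of a gcd of \<open>f\<close> and \<open>g\<close>.\<close>
    define I where "I = {a * f + b * g | a b. a \<in> ?C \<and> b \<in> ?C}"
    have "1 * f + 0 * g \<in> I" "0 * f + 1 * g \<in> I"
      unfolding I_def using C.one_in C.zero_in by blast+
    then have "f \<in> I" "g \<in> I"
      by simp_all
    define r where "r = (ARG_MIN (deg_in x) r. r \<in> I \<and> r \<noteq> 0)"
    have r: "r \<in> I \<and> r \<noteq> 0"
      unfolding r_def using \<open>f \<in> I\<close> f
      by (intro arg_min_natI[of "\<lambda>r. r \<in> I \<and> r \<noteq> 0" f "deg_in x"]) simp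
    have min: "deg_in x r \<le> deg_in x s" if "s \<in> I" "s \<noteq> 0" for s
      unfolding r_def using that
      by (intro arg_min_nat_le[of "\<lambda>r. r \<in> I \<and> r \<noteq> 0" s "deg_in x"]) simp
    obtain a b where ab: "r = a * f + b * g" "a \<in> ?C" "b \<in> ?C"
      using r by (auto simp: I_def)
    have r_C: "r \<in> ?C"
      unfolding ab using ab insert.prems C.add_in C.mult_in by blast
    have I_closed: "c * p - q * r \<in> I" if cpq: "c \<in> ?C" "p \<in> I" "q \<in> ?C" for c p q
    proof -
      obtain a' b' where p: "p = a' * f + b' * g" "a' \<in> ?C" "b' \<in> ?C"
        using cpq by (auto simp: I_def)
      have "c * p - q * r = (c * a' - q * a) * f + (c * b' - q * b) * g"
        by (simp add: p ab algebra_simps)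
      moreover have "c * a' - q * a \<in> ?C" "c * b' - q * b \<in> ?C"
        using cpq p ab C.diff_in C.mult_in by auto
      ultimately show ?thesis by (auto simp: I_def)
    qed
    \<comment> \<open>Pseudo-division by \<open>r\<close> keeps the remainder in \<open>I\<close>,
      so the minimal degree of \<open>r\<close> makes it zero.\<close>
    have div: "\<exists>c q. c \<in> mpolys V \<and> c \<noteq> 0 \<and> q \<in> ?C \<and> c * p = r * q" if p: "p \<in> I" "p \<in> ?C" for p
    proof -
      obtain c q s where *: "c \<in> mpolys V" "c \<noteq> 0" "q \<in> ?C" "c * p = q * r + s"
        "s = 0 \<or> deg_in x s < deg_in x r"
        using pseudo_division[OF insert.hyps(2) r_C _ p(2)] r by blast
      have "s = c * p - q * r"
        using *(4) by simp
      then have "s \<in> I"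
        using I_closed[OF sub[OF *(1)] p(1) *(3)] by (simp only:)
      then have "s = 0"
        using min * by force
      then show ?thesis
        using * by (intro exI[of _ c] exI[of _ q]) (auto simp: mult.commute)
    qed
    obtain c q where cq: "c \<in> mpolys V" "c \<noteq> 0" "q \<in> ?C" "c * f = r * q"
      using div[OF \<open>f \<in> I\<close> insert.prems(1)] by blast
    obtain c1 c2 r' q' where *: "c = c1 * c2" "r = c1 * r'" "q = c2 * q'" "f = r' * q'"
      using split[OF _ _ _ _ _ cq(1,2) r_C cq(3,4)] by blast
    \<comment> \<open>Irreducibility of \<open>f = r' * q'\<close> gives the two possibilities for a
      gcd: either \<open>f\<close> divides \<open>r\<close>, or \<open>r\<close> is free of
      \<open>x\<close>.\<close>
    from insert.prems(2) *(4) have "r' dvd 1 \<or> q' dvd 1"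
      by (auto simp: irreducible_def)
    then show ?thesis
    proof
      assume "q' dvd 1"
      then obtain d where "1 = q' * d" ..
      then have "r' = f * d"
        using *(4) by (simp add: mult.assoc)
      then have "f dvd r"
        using *(2) by simp
      obtain c' q2 where "c' \<in> mpolys V" "c' \<noteq> 0" "c' * g = r * q2"
        using div[OF \<open>g \<in> I\<close> insert.prems(3)] by blast
      then show ?thesis
        using cancel[of c' g] insert.prems(3) \<open>f dvd r\<close> by simp
    next
      assume "r' dvd 1"
      then obtain d where "r' = Const d"
        by (rule dvd_1_Const)
      moreover have "c1 \<in> mpolys V"
        using * cq mult_in_mpolysD(1)[of c1 c2 V] by auto
      ultimately have "r \<in> mpolys V"
        using *(2) filtration.mult_in[OF filtration_mpolys, of c1 V r'] by auto
      \<comment> \<open>Multiplying the Bezout relation for \<open>r\<close> by \<open>h\<close>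
        makes both summands multiples of \<open>f\<close>.\<close>
      moreover have "f dvd r * h"
      proof -
        have "r * h = f * (a * h) + b * (g * h)"
          by (simp add: ab algebra_simps)
        then show ?thesis using insert.prems(5) by simp
      qed
      ultimately show ?thesis
        using cancel[of r h] r insert.prems(4) by blast
    qed
  qed
qed

section \<open>Minors, kernels and resultants\<close>

text \<open>
  The kernel vector consists of the cofactors along a last row appended to a nonzero minor of one size
  less; this keeps its entries in the subring \<open>S\<close>.
\<close>

lemma minor_or_kernel:
  fixes M :: "nat \<Rightarrow> nat \<Rightarrow> 'r::idom"
  assumes "filtration (\<lambda>_. S)" "\<And>k j. k \<in> I \<Longrightarrow> j < N \<Longrightarrow> M k j \<in> S"
  shows "(\<exists>r. (\<forall>i<N. r i \<in> I) \<and> det (mat N N (\<lambda>(i, j). M (r i) j)) \<noteq> 0) \<or>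
    (\<exists>c. (\<exists>j<N. c j \<noteq> 0) \<and> (\<forall>j<N. c j \<in> S) \<and> (\<forall>k\<in>I. (\<Sum>j<N. M k j * c j) = 0))"
  using assms(2)
proof (induction N)
  case 0
  show ?case by simp
next
  case (Suc N)
  interpret filtration "\<lambda>_. S" by fact
  have "(\<exists>r. (\<forall>i<N. r i \<in> I) \<and> det (mat N N (\<lambda>(i, j). M (r i) j)) \<noteq> 0) \<or>
    (\<exists>c. (\<exists>j<N. c j \<noteq> 0) \<and> (\<forall>j<N. c j \<in> S) \<and> (\<forall>k\<in>I. (\<Sum>j<N. M k j * c j) = 0))"
    using Suc by auto
  then consider r where "\<forall>i<N. r i \<in> I" "det (mat N N (\<lambda>(i, j). M (r i) j)) \<noteq> 0"
    | c j where "j < N" "c j \<noteq> 0" "\<forall>j<N. c j \<in> S" "\<forall>k\<in>I. (\<Sum>j<N. M k j * c j) = 0"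
    by blast
  then show ?case
  proof cases
    case c: (2 c j)
    then show ?thesis
      using c zero_in by (intro disjI2 exI[of _ "c(N := 0)"]) (auto intro!: exI[of _ j])
  next
    case r: (1 r)
    define C where "C j = (- 1) ^ (N + j) *
      det (mat N N (\<lambda>(i, j'). M (r i) (if j' < j then j' else Suc j')))" for j
    have C_in: "C j \<in> S" if "j < Suc N" for j
    proof -
      have "det (mat N N (\<lambda>(i, j'). M (r i) (if j' < j then j' else Suc j'))) \<in> S"
        by (rule det_in[where n = N]) (use r Suc.prems in auto)
      moreover have "(- 1) ^ (N + j) \<in> S"
        using power_in uminus_in one_in by blast
      ultimately show ?thesis
        unfolding C_def by (rule mult_in[rotated])
    qed
    \<comment> \<open>Deleting the last column gives back the old minor, so \<open>C\<close> is not
      the zero vector.\<close>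
    have "mat N N (\<lambda>(i, j'). M (r i) (if j' < N then j' else Suc j')) = mat N N (\<lambda>(i, j). M (r i) j)"
      by auto
    then have C_N: "C N \<noteq> 0"
      using r by (simp add: C_def)
    \<comment> \<open>The cofactors along the last row do not depend on that row. The same
      \<open>C\<close> serves for all \<open>k\<close>: either it is a kernel vector, or some
      \<open>k\<close> extends the minor.\<close>
    have expand: "det (mat (Suc N) (Suc N) (\<lambda>(i, j). M (if i < N then r i else k) j)) =
      (\<Sum>j<Suc N. M k j * C j)" for k
    proof -
      let ?A = "mat (Suc N) (Suc N) (\<lambda>(i, j). M (if i < N then r i else k) j)"
      have "mat_delete ?A N j = mat N N (\<lambda>(i, j'). M (r i) (if j' < j then j' else Suc j'))"
        if "j < Suc N" for j
        by (rule eq_matI) (auto simp: mat_delete_def)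
      then have "cofactor ?A N j = C j" if "j < Suc N" for j
        using that by (simp add: cofactor_def C_def)
      moreover have "det ?A = (\<Sum>j<Suc N. ?A $$ (N, j) * cofactor ?A N j)"
        by (rule laplace_expansion_row) auto
      ultimately show ?thesis
        by (auto intro: sum.cong)
    qed
    show ?thesis
    proof (cases "\<forall>k\<in>I. (\<Sum>j<Suc N. M k j * C j) = 0")
      case True
      then show ?thesis
        using C_in C_N by blast
    next
      case False
      then obtain k where "k \<in> I" "(\<Sum>j<Suc N. M k j * C j) \<noteq> 0"
        by blast
      then show ?thesis
        using r expand[of k]
        by (intro disjI1 exI[of _ "\<lambda>i. if i < N then r i else k"]) auto
    qed
  qed
qed

text \<open>Two equal rows kill the determinant. Distinctness of the rows is what later saves
  N(N-1)/2 in the degree bound for a minor.\<close>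

lemma inj_on_rows_of_det_nonzero:
  fixes M :: "nat \<Rightarrow> nat \<Rightarrow> 'r::comm_ring_1"
  assumes "det (mat N N (\<lambda>(i, j). M (r i) j)) \<noteq> 0"
  shows "inj_on r {..<N}"
proof (rule inj_onI, rule ccontr)
  fix i j assume ij: "i \<in> {..<N}" "j \<in> {..<N}" "r i = r j" "i \<noteq> j"
  have "row (mat N N (\<lambda>(i, j). M (r i) j)) i = row (mat N N (\<lambda>(i, j). M (r i) j)) j"
    using ij by auto
  then have "det (mat N N (\<lambda>(i, j). M (r i) j)) = 0"
    using ij by (intro det_identical_rows[of _ N i j]) auto
  with assms show False by simp
qed

text \<open>With only \<open>N\<close> rows to choose from, a nonzero minor would use each row once
  and equal \<open>det A\<close> up to sign.\<close>

lemma kernel_of_det_zero: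
  fixes A :: "'r::idom mat"
  assumes S: "filtration (\<lambda>_. S)" and A: "A \<in> carrier_mat N N" "det A = 0"
    and entry: "\<And>i j. i < N \<Longrightarrow> j < N \<Longrightarrow> A $$ (i, j) \<in> S"
  obtains c where "\<exists>j<N. c j \<noteq> 0" "\<And>j. j < N \<Longrightarrow> c j \<in> S"
    "\<And>i. i < N \<Longrightarrow> (\<Sum>j<N. A $$ (i, j) * c j) = 0"
proof -
  have "\<not> (\<exists>r. (\<forall>i<N. r i \<in> {..<N}) \<and> det (mat N N (\<lambda>(i, j). A $$ (r i, j))) \<noteq> 0)"
  proof safe
    fix r assume r: "\<forall>i<N. r i \<in> {..<N}" "det (mat N N (\<lambda>(i, j). A $$ (r i, j))) \<noteq> 0"
    \<comment> \<open>\<open>permutes\<close> requires the identity outside the index range.\<close>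
    define p where "p i = (if i < N then r i else i)" for i
    have "inj_on r {..<N}"
      using inj_on_rows_of_det_nonzero[of N "\<lambda>i j. A $$ (i, j)" r] r by simp
    then have inj: "inj_on p {..<N}"
      by (auto simp: inj_on_def p_def)
    have "p ` {..<N} \<subseteq> {..<N}"
      using r by (auto simp: p_def)
    then have "p ` {..<N} = {..<N}"
      using inj by (intro endo_inj_surj) auto
    then have "p permutes {0..<N}"
      using inj by (intro bij_imp_permutes) (auto simp: bij_betw_def p_def atLeast0LessThan)
    from det_permute_rows[OF A(1) this]
    have "det (mat N N (\<lambda>(i, j). A $$ (p i, j))) = 0"
      using A by simp
    moreover have "mat N N (\<lambda>(i, j). A $$ (p i, j)) = mat N N (\<lambda>(i, j). A $$ (r i, j))"
      by (rule eq_matI) (auto simp: p_def)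
    ultimately show False
      using r by simp
  qed
  moreover have "A $$ (i, j) \<in> S" if "i \<in> {..<N}" "j < N" for i j
    using entry that by simp
  ultimately obtain c where "\<exists>j<N. c j \<noteq> 0" "\<forall>j<N. c j \<in> S" "\<forall>i\<in>{..<N}. (\<Sum>j<N. A $$ (i, j) * c j) = 0"
    using minor_or_kernel[OF S, of "{..<N}" N "\<lambda>i j. A $$ (i, j)"] by blast
  then show ?thesis
    by (intro that[of c]) auto
qed

text \<open>In increasing order the elements are at least 0, 1, 2 and so on. The doubled form avoids
  halving in the naturals.\<close>

lemma card_times_le_sum:
  fixes A :: "nat set"
  assumes "finite A"
  shows "card A * (card A - 1) \<le> 2 * \<Sum>A"
  using assms
proof (induction A rule: finite_linorder_max_induct)
  case (insert m A)
  have "A \<subseteq> {..<m}"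
    using insert by auto
  then have "card A \<le> m"
    using card_mono[of "{..<m}" A] by simp
  then have "card A * (card A - 1) + 2 * card A \<le> 2 * \<Sum>A + 2 * m"
    using insert.IH by linarith
  moreover have "card (insert m A) = Suc (card A)" "\<Sum>(insert m A) = m + \<Sum>A"
    using insert by auto
  moreover have "Suc (card A) * card A = card A * (card A - 1) + 2 * card A"
    by (cases "card A") (auto simp: algebra_simps)
  ultimately show ?case by simp
qed auto

text \<open>The numbers \<open>K - r i\<close> are distinct naturals, so their sum is at least 0 + 1
  + ... + (N - 1).\<close>

lemma sum_distinct_le:
  fixes r :: "nat \<Rightarrow> nat"
  assumes "inj_on r {..<N}" "\<And>i. i < N \<Longrightarrow> r i \<le> K"
  shows "2 * (\<Sum>i<N. r i) + N * (N - 1) \<le> 2 * (N * K)"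
proof -
  have inj: "inj_on (\<lambda>i. K - r i) {..<N}"
  proof (rule inj_onI)
    fix i j assume ij: "i \<in> {..<N}" "j \<in> {..<N}" "K - r i = K - r j"
    then have "r i = r j"
      using assms(2)[of i] assms(2)[of j] by auto
    with ij assms(1) show "i = j" by (auto simp: inj_on_def)
  qed
  have "N * (N - 1) \<le> 2 * (\<Sum>i<N. K - r i)"
    using card_times_le_sum[of "(\<lambda>i. K - r i) ` {..<N}"] inj
    by (simp add: card_image sum.reindex)
  moreover have "(\<Sum>i<N. K - r i) + (\<Sum>i<N. r i) = (\<Sum>i<N. K)"
    unfolding sum.distrib[symmetric] using assms(2) by (intro sum.cong) auto
  ultimately show ?thesis by simp
qed

section \<open>Sylvester matrices and resultants\<close>

lemma sylvester_row:
  fixes P Q :: "'r::comm_ring_1 poly"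
  assumes "Polynomial.degree P \<le> m" "Polynomial.degree Q \<le> n" "i < m + n"
  shows "(\<Sum>j<m + n. Polynomial.monom (sylvester_mat_sub m n P Q $$ (i, j)) (m + n - 1 - j)) =
    (if i < n then Polynomial.monom 1 (n - 1 - i) * P else Polynomial.monom 1 (m + n - 1 - i) * Q)"
proof (rule poly_eqI)
  fix t
  let ?S = "sylvester_mat_sub m n P Q"
  have "Polynomial.coeff (\<Sum>j<m + n. Polynomial.monom (?S $$ (i, j)) (m + n - 1 - j)) t =
      (\<Sum>j<m + n. if m + n - 1 - j = t then ?S $$ (i, j) else 0)"
    by (simp add: Polynomial.coeff_sum)
  \<comment> \<open>Columns run through decreasing powers, so the power \<open>t\<close> sits in
    column \<open>m + n - 1 - t\<close>.\<close>
  also have "\<dots> = (if t < m + n then ?S $$ (i, m + n - 1 - t) else 0)"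
  proof (cases "t < m + n")
    case True
    have "(\<Sum>j<m + n. if m + n - 1 - j = t then ?S $$ (i, j) else 0) =
        (\<Sum>j<m + n. if j = m + n - 1 - t then ?S $$ (i, j) else 0)"
      using True by (intro sum.cong) auto
    also have "\<dots> = ?S $$ (i, m + n - 1 - t)"
      using True by (subst sum.delta) auto
    finally show ?thesis using True by simp
  qed (auto intro!: sum.neutral)
  also have "\<dots> = Polynomial.coeff (if i < n then Polynomial.monom 1 (n - 1 - i) * P
      else Polynomial.monom 1 (m + n - 1 - i) * Q) t"
  proof (cases "i < n")
    case True
    then show ?thesis
      using assms
      by (auto simp: sylvester_mat_sub_index coeff_monom_mult intro!: arg_cong[of _ _ "Polynomial.coeff P"]
          coeff_eq_0 coeff_eq_0[symmetric])
  next
    case False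
    then show ?thesis
      using assms
      by (auto simp: sylvester_mat_sub_index coeff_monom_mult intro!: arg_cong[of _ _ "Polynomial.coeff Q"]
          coeff_eq_0 coeff_eq_0[symmetric])
  qed
  finally show "Polynomial.coeff (\<Sum>j<m + n. Polynomial.monom (?S $$ (i, j)) (m + n - 1 - j)) t =
    Polynomial.coeff (if i < n then Polynomial.monom 1 (n - 1 - i) * P
      else Polynomial.monom 1 (m + n - 1 - i) * Q) t" .
qed

text \<open>Multiplying the Sylvester matrix by its adjugate expresses the determinant as a
  combination of shifts of \<open>P\<close> and \<open>Q\<close>. The numbers \<open>m\<close> and
  \<open>n\<close> only bound the degrees, which covers derivatives of unexpectedly small
  degree.\<close>

lemma resultant_sub_in_ideal:
  fixes P Q :: "'r::comm_ring_1 poly"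
  assumes "Polynomial.degree P \<le> m" "Polynomial.degree Q \<le> n" "0 < m + n"
  obtains u v where "resultant_sub m n P Q = u * poly P a + v * poly Q a"
proof -
  let ?S = "sylvester_mat_sub m n P Q"
  define N where "N = m + n"
  have S: "?S \<in> carrier_mat N N"
    unfolding N_def by (rule sylvester_mat_sub_carrier)
  \<comment> \<open>The last row of the adjugate isolates the last column, which belongs to the
    constant terms.\<close>
  define A where "A i = adj_mat ?S $$ (N - 1, i)" for i
  define b where "b i = (\<Sum>j<N. ?S $$ (i, j) * a ^ (N - 1 - j))" for i
  have b: "b i = (if i < n then a ^ (n - 1 - i) * poly P a else a ^ (N - 1 - i) * poly Q a)"
    if "i < N" for i
    using arg_cong[OF sylvester_row[OF assms(1,2), of i], of "\<lambda>p. poly p a"] that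
    by (auto simp: poly_sum poly_monom b_def N_def)
  have adj: "(\<Sum>i<N. A i * ?S $$ (i, j)) = (if j = N - 1 then det ?S else 0)" if "j < N" for j
  proof -
    have "(adj_mat ?S * ?S) $$ (N - 1, j) = (\<Sum>i<N. A i * ?S $$ (i, j))"
      using S adj_mat(1)[OF S] that assms(3)
      by (auto simp: scalar_prod_def A_def atLeast0LessThan N_def)
    moreover have "(adj_mat ?S * ?S) $$ (N - 1, j) = (if j = N - 1 then det ?S else 0)"
      using that assms(3) by (auto simp: adj_mat(3)[OF S] N_def)
    ultimately show ?thesis by simp
  qed
  have "(\<Sum>i<N. A i * b i) = (\<Sum>i<N. \<Sum>j<N. A i * ?S $$ (i, j) * a ^ (N - 1 - j))"
    by (simp add: b_def sum_distrib_left mult.assoc)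
  also have "\<dots> = (\<Sum>j<N. (\<Sum>i<N. A i * ?S $$ (i, j)) * a ^ (N - 1 - j))"
    by (subst sum.swap) (simp add: sum_distrib_right)
  also have "\<dots> = (\<Sum>j<N. if j = N - 1 then det ?S * a ^ (N - 1 - j) else 0)"
    using adj by (intro sum.cong) auto
  also have "\<dots> = det ?S"
    using assms(3) by (subst sum.delta) (auto simp: N_def)
  finally have "det ?S = (\<Sum>i<N. A i * b i)" ..
  also have "\<dots> = (\<Sum>i<N. (if i < n then A i * a ^ (n - 1 - i) else 0) * poly P a +
      (if i < n then 0 else A i * a ^ (N - 1 - i)) * poly Q a)"
    using b by (intro sum.cong) auto
  also have "\<dots> = (\<Sum>i<N. if i < n then A i * a ^ (n - 1 - i) else 0) * poly P a +
      (\<Sum>i<N. if i < n then 0 else A i * a ^ (N - 1 - i)) * poly Q a"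
    by (simp add: sum.distrib sum_distrib_right)
  finally show ?thesis
    using that by (simp add: resultant_sub_def)
qed

text \<open>A dependence among the Sylvester rows gives the cofactors of \<open>P\<close> and
  \<open>Q\<close>. Only the last rows, as many as the degree of \<open>P\<close>, contribute to
  \<open>w\<close>, which keeps its degree below that of \<open>P\<close>.\<close>

lemma resultant_eq_0_relation:
  fixes P Q :: "'r::idom poly"
  assumes S: "filtration (\<lambda>_. S)" and res: "resultant P Q = 0"
    and coeffs: "\<And>i. Polynomial.coeff P i \<in> S" "\<And>i. Polynomial.coeff Q i \<in> S"
    and P: "P \<noteq> 0"
  obtains u w where "u * P + w * Q = 0" "w \<noteq> 0" "Polynomial.degree w < Polynomial.degree P"
    "\<And>i. Polynomial.coeff u i \<in> S" "\<And>i. Polynomial.coeff w i \<in> S"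
proof -
  interpret filtration "\<lambda>_. S" by fact
  define m n N where "m = Polynomial.degree P" and "n = Polynomial.degree Q" and "N = m + n"
  let ?S = "sylvester_mat_sub m n P Q"
  have carrier: "?S \<in> carrier_mat N N"
    unfolding N_def by (rule sylvester_mat_sub_carrier)
  have "det ?S = 0"
    using res by (simp add: resultant_sub resultant_sub_def m_def n_def)
  \<comment> \<open>Kernel vectors of the transpose are the dependences among the rows.\<close>
  then have det: "det ?S\<^sup>T = 0"
    using carrier by (simp add: Determinant.det_transpose)
  have entry: "?S\<^sup>T $$ (i, j) \<in> S" if "i < N" "j < N" for i j
    using that coeffs zero_in carrier
    by (auto simp: sylvester_mat_sub_index N_def)
  obtain c where c: "\<exists>j<N. c j \<noteq> 0" "\<And>j. j < N \<Longrightarrow> c j \<in> S"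
    "\<And>i. i < N \<Longrightarrow> (\<Sum>j<N. ?S\<^sup>T $$ (i, j) * c j) = 0"
    by (rule kernel_of_det_zero[OF S _ det entry]) (use carrier in auto)
  define u where "u = (\<Sum>i<N. if i < n then Polynomial.monom (c i) (n - 1 - i) else 0)"
  define w where "w = (\<Sum>i<N. if i < n then 0 else Polynomial.monom (c i) (N - 1 - i))"
  have "u * P + w * Q = (\<Sum>i<N. smult (c i) (if i < n then Polynomial.monom 1 (n - 1 - i) * P
      else Polynomial.monom 1 (N - 1 - i) * Q))"
    unfolding u_def w_def sum_distrib_right sum.distrib[symmetric]
    by (intro sum.cong) (auto simp flip: mult_smult_left simp: smult_monom)
  also have "\<dots> = (\<Sum>i<N. smult (c i) (\<Sum>j<N. Polynomial.monom (?S $$ (i, j)) (N - 1 - j)))"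
    using sylvester_row[of P m Q n]
    by (intro sum.cong) (auto simp: N_def m_def n_def)
  also have "\<dots> = (\<Sum>i<N. \<Sum>j<N. Polynomial.monom (c i * ?S $$ (i, j)) (N - 1 - j))"
    by (simp add: smult_sum2 smult_monom)
  also have "\<dots> = (\<Sum>j<N. Polynomial.monom (\<Sum>i<N. c i * ?S $$ (i, j)) (N - 1 - j))"
    by (subst sum.swap) (simp add: monom_sum)
  also have "\<dots> = 0"
  proof (intro sum.neutral ballI)
    fix j assume j: "j \<in> {..<N}"
    have "(\<Sum>i<N. c i * ?S $$ (i, j)) = (\<Sum>i<N. ?S\<^sup>T $$ (j, i) * c i)"
      using carrier j by (intro sum.cong) auto
    then have "(\<Sum>i<N. c i * ?S $$ (i, j)) = 0"
      using c(3)[of j] j by simp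
    then show "Polynomial.monom (\<Sum>i<N. c i * ?S $$ (i, j)) (N - 1 - j) = 0"
      by simp
  qed
  finally have rel: "u * P + w * Q = 0" .
  have coeff_u: "Polynomial.coeff u (n - 1 - i) = c i" if "i < n" for i
  proof -
    have "Polynomial.coeff u (n - 1 - i) = (\<Sum>k<N. if k = i then c k else 0)"
      unfolding u_def Polynomial.coeff_sum using that by (intro sum.cong) auto
    then show ?thesis
      using that by (simp add: N_def)
  qed
  have coeff_w: "Polynomial.coeff w (N - 1 - i) = c i" if "n \<le> i" "i < N" for i
  proof -
    have "Polynomial.coeff w (N - 1 - i) = (\<Sum>k<N. if k = i then c k else 0)"
      unfolding w_def Polynomial.coeff_sum using that by (intro sum.cong) auto
    then show ?thesis
      using that by simp
  qed
  \<comment> \<open>If \<open>w\<close> vanished, so would \<open>u\<close>, because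
    \<open>P\<close> is nonzero; then all entries of \<open>c\<close> would vanish.\<close>
  have "w \<noteq> 0"
  proof
    assume "w = 0"
    then have "u = 0"
      using rel P by simp
    obtain j where j: "j < N" "c j \<noteq> 0"
      using c(1) by blast
    show False
      using coeff_u[of j] coeff_w[of j] j \<open>u = 0\<close> \<open>w = 0\<close> by (cases "j < n") auto
  qed
  moreover have "Polynomial.degree w < m"
  proof -
    have "w = 0" if "m = 0"
      unfolding w_def using that by (intro sum.neutral) (auto simp: N_def)
    then have "m \<noteq> 0"
      using \<open>w \<noteq> 0\<close> by auto
    moreover have "Polynomial.degree w \<le> m - 1"
      unfolding w_def by (intro degree_sum_le) (auto simp: N_def intro!: order.trans[OF degree_monom_le])
    ultimately show ?thesis by simp
  qed
  moreover have "Polynomial.coeff u i \<in> S" "Polynomial.coeff w i \<in> S" for i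
    unfolding u_def w_def Polynomial.coeff_sum using c(2) zero_in by (auto intro!: sum_in)
  ultimately show ?thesis
    using that rel by (auto simp: m_def)
qed

section \<open>Partial evaluations\<close>

lemma map_poly_const_hom:
  assumes "comm_ring_hom h"
  shows "map_poly h [:c:] = [:h c:]" "map_poly h [:0, 1:] = [:0, 1:]"
proof -
  interpret comm_ring_hom h by fact
  show "map_poly h [:c:] = [:h c:]" "map_poly h [:0, 1:] = [:0, 1:]"
    by (simp_all add: map_poly_pCons_hom)
qed

lemma map_poly_as_poly_in:
  assumes "comm_ring_hom \<iota>"
  shows "map_poly (subst \<iota> s) (as_poly_in x p) =
    subst (\<lambda>c. [:\<iota> c:]) (\<lambda>i. if i = x then [:0, 1:] else [:s i:]) p"
proof -
  interpret s: comm_ring_hom "subst \<iota> s"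
    by (rule comm_ring_hom_subst[OF assms])
  have "map_poly (subst \<iota> s) (as_poly_in x p) = subst (\<lambda>c. map_poly (subst \<iota> s) [:Const c:])
      (\<lambda>i. map_poly (subst \<iota> s) (if i = x then [:0, 1:] else [:Var i:])) p"
    unfolding as_poly_in_def by (rule hom_subst[OF comm_ring_hom_map_poly[OF s.comm_ring_hom_axioms]])
  also have "(\<lambda>c. map_poly (subst \<iota> s) [:Const c:]) = (\<lambda>c. [:\<iota> c:])"
    by (rule ext) (simp add: subst_Const[OF assms] map_poly_const_hom[OF s.comm_ring_hom_axioms])
  also have "(\<lambda>i. map_poly (subst \<iota> s) (if i = x then [:0, 1:] else [:Var i:])) =
      (\<lambda>i. if i = x then [:0, 1:] else [:s i:])"
    by (rule ext) (simp add: subst_Var[OF assms] map_poly_const_hom[OF s.comm_ring_hom_axioms])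
  finally show ?thesis .
qed

text \<open>Reduces an evaluation of \<chi> to the images of X, Y, the Z_i and the constants.
  Identities between evaluations then compare two substitutions into \<open>f\<close>.\<close>

lemma chi_hom:
  assumes "comm_ring_hom \<phi>"
  shows "\<phi> (chi f \<nu> \<omega>) = subst (\<lambda>c. \<phi> (Const (to_ac c)))
    (\<lambda>i. if i = 1 then \<phi> (Var 0) + \<phi> (Const (\<nu> 1))
         else \<phi> (Const (\<omega> i)) * \<phi> (Var 0) + \<phi> (Var i) * \<phi> (Var 1) + \<phi> (Const (\<nu> i))) f"
proof -
  interpret comm_ring_hom \<phi> by fact
  show ?thesis
    unfolding chi_def hom_subst[OF assms]
    by (intro arg_cong[of _ _ "\<lambda>s. subst _ s f"] ext) (simp add: hom_add hom_mult)
qed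

text \<open>The remainder is built by Horner's rule, without dividing by 2, so the expansion holds
  in every characteristic.\<close>

lemma poly_taylor2:
  fixes P :: "'r::idom poly"
  obtains r where "poly P (a + b) = poly P a + b * poly (pderiv P) a + b\<^sup>2 * r"
proof -
  have "\<exists>r. poly P (a + b) = poly P a + b * poly (pderiv P) a + b\<^sup>2 * r"
  proof (induction P)
    case 0
    show ?case by (intro exI[of _ 0]) simp
  next
    case (pCons c P)
    then obtain r where r: "poly P (a + b) = poly P a + b * poly (pderiv P) a + b\<^sup>2 * r"
      by blast
    show ?case
      by (intro exI[of _ "poly (pderiv P) a + (a + b) * r"])
        (simp add: pderiv_pCons r power2_eq_square algebra_simps)
  qed
  then show ?thesis using that by blast
qed

text \<open>A factor \<open>q\<close> with nonzero constant term can be cancelled modulo a power of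
  the variable: the coefficients of \<open>p\<close> vanish one after another.\<close>

lemma coeff_mult_eq_0D:
  fixes p q :: "'r::idom poly"
  assumes "Polynomial.coeff q 0 \<noteq> 0" "\<And>k. k < n \<Longrightarrow> Polynomial.coeff (p * q) k = 0" "k < n"
  shows "Polynomial.coeff p k = 0"
  using assms(3)
proof (induction k rule: less_induct)
  case (less k)
  have "0 = (\<Sum>i\<le>k. Polynomial.coeff p i * Polynomial.coeff q (k - i))"
    using assms(2)[OF less.prems] by (simp add: Polynomial.coeff_mult)
  also have "\<dots> = (\<Sum>i\<le>k. if i = k then Polynomial.coeff p k * Polynomial.coeff q 0 else 0)"
    using less by (intro sum.cong) auto
  finally show ?case
    using assms(1) by simp
qed

lemma coeff_mult_top:
  assumes "Polynomial.degree p \<le> i" "Polynomial.degree q \<le> j"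
  shows "Polynomial.coeff (p * q) (i + j) = Polynomial.coeff p i * Polynomial.coeff q j"
proof -
  have "Polynomial.coeff p k * Polynomial.coeff q (i + j - k) =
      (if k = i then Polynomial.coeff p i * Polynomial.coeff q j else 0)" if "k \<le> i + j" for k
  proof (cases k i rule: linorder_cases)
    case less
    then have "Polynomial.degree q < i + j - k"
      using assms that by simp
    then show ?thesis
      using less by (simp add: coeff_eq_0)
  next
    case greater
    then have "Polynomial.degree p < k"
      using assms by simp
    then show ?thesis
      using greater by (simp add: coeff_eq_0)
  qed simp
  then have "Polynomial.coeff (p * q) (i + j) =
      (\<Sum>k\<le>i + j. if k = i then Polynomial.coeff p i * Polynomial.coeff q j else 0)"
    unfolding Polynomial.coeff_mult by (intro sum.cong) auto
  then show ?thesis by simp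
qed

text \<open>For a polynomial evaluated along b + t a, this identifies the top coefficient in t with
  the leading form evaluated at a.\<close>

lemma mon_eval_linear_top:
  fixes a b :: "'v \<Rightarrow> 'r::comm_ring_1"
  shows "Polynomial.degree (mon_eval (\<lambda>i. [:b i, a i:]) m) \<le> monom_degree m"
    and "Polynomial.coeff (mon_eval (\<lambda>i. [:b i, a i:]) m) (monom_degree m) = mon_eval a m"
proof -
  have pow: "Polynomial.degree ([:b i, a i:] ^ k) \<le> k \<and> Polynomial.coeff ([:b i, a i:] ^ k) k = a i ^ k"
    for i k
  proof (induction k)
    case (Suc k)
    have "Polynomial.degree [:b i, a i:] \<le> 1"
      by (simp add: degree_pCons_le)
    then show ?case
      using Suc coeff_mult_top[of "[:b i, a i:]" 1 "[:b i, a i:] ^ k" k]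
        degree_mult_le[of "[:b i, a i:]" "[:b i, a i:] ^ k"] by simp
  qed simp
  have "Polynomial.degree (\<Prod>i\<in>A. [:b i, a i:] ^ l i) \<le> (\<Sum>i\<in>A. l i) \<and>
    Polynomial.coeff (\<Prod>i\<in>A. [:b i, a i:] ^ l i) (\<Sum>i\<in>A. l i) = (\<Prod>i\<in>A. a i ^ l i)"
    if "finite A" for A l
    using that
  proof (induction A rule: finite_induct)
    case (insert i A)
    then show ?case
      using pow[of i "l i"] coeff_mult_top[of "[:b i, a i:] ^ l i" "l i" "\<Prod>i\<in>A. [:b i, a i:] ^ l i" "\<Sum>i\<in>A. l i"]
        degree_mult_le[of "[:b i, a i:] ^ l i" "\<Prod>i\<in>A. [:b i, a i:] ^ l i"]
      by (auto simp del: power_Suc)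
  qed simp
  then show "Polynomial.degree (mon_eval (\<lambda>i. [:b i, a i:]) m) \<le> monom_degree m"
    "Polynomial.coeff (mon_eval (\<lambda>i. [:b i, a i:]) m) (monom_degree m) = mon_eval a m"
    by (auto simp: mon_eval_def monom_degree_def)
qed

section \<open>Monomials of bounded degree and nested polynomial rings in X and Y\<close>

lemma card_pairs_le: "card {(a, b). a + b \<le> (D::nat)} = (D + 1) * (D + 2) div 2"
proof -
  have eq: "{(a, b). a + b \<le> D} = Sigma {..D} (\<lambda>a. {..D - a})"
    by auto
  have "card {(a, b). a + b \<le> D} = (\<Sum>a\<le>D. Suc (D - a))"
    unfolding eq by (subst card_SigmaI) auto
  also have "\<dots> = (\<Sum>a\<le>D. Suc a)"
    by (rule sum.reindex_bij_witness[of _ "\<lambda>a. D - a" "\<lambda>a. D - a"]) auto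
  also have "\<dots> = (D + 1) * (D + 2) div 2"
    by (induction D) auto
  finally show ?thesis .
qed

lemma finite_pairs_le: "finite {(a, b). a + b \<le> (D::nat)}"
  by (rule finite_subset[of _ "{..D} \<times> {..D}"]) auto

text \<open>The outer variable is X, the inner one is Y, and Z stays in the coefficients.
  \<open>at_XY\<close> uses the same nesting with Z specialized to \<eta>, and \<open>ev_X\<close>
  replaces X by a polynomial \<alpha> in Y.\<close>

definition lift_XY :: "(nat, 'a::comm_ring_1) mpoly \<Rightarrow> (nat, 'a) mpoly poly poly" where
  "lift_XY = subst (\<lambda>c. [:[:Const c:]:])
     (\<lambda>i. if i = 0 then [:0, 1:] else if i = 1 then [:[:0, 1:]:] else [:[:Var i:]:])"

definition at_XY :: "(nat \<Rightarrow> 'a) \<Rightarrow> (nat, 'a::comm_ring_1) mpoly \<Rightarrow> 'a poly poly" where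
  "at_XY \<eta> = subst (\<lambda>c. [:[:c:]:])
     (\<lambda>i. if i = 0 then [:0, 1:] else if i = 1 then [:[:0, 1:]:] else [:[:\<eta> i:]:])"

definition ev_X :: "(nat, 'a::comm_ring_1) mpoly poly \<Rightarrow> (nat, 'a) mpoly \<Rightarrow> (nat, 'a) mpoly poly" where
  "ev_X \<alpha> = subst (\<lambda>c. [:Const c:])
     (\<lambda>i. if i = 0 then \<alpha> else if i = 1 then [:0, 1:] else [:Var i:])"

lemma comm_ring_hom_pCons2: "comm_ring_hom (\<lambda>c. [:[:c:]:])"
  by (rule comm_ring_hom_comp[OF comm_ring_hom_pCons_0 comm_ring_hom_pCons_0])

lemma comm_ring_hom_Const_pCons2: "comm_ring_hom (\<lambda>c. [:[:Const c:]:])"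
  by (rule comm_ring_hom_comp[OF comm_ring_hom_pCons2 comm_ring_hom_Const])

lemma comm_ring_hom_lift_XY: "comm_ring_hom lift_XY"
  unfolding lift_XY_def by (rule comm_ring_hom_subst[OF comm_ring_hom_Const_pCons2])

lemma comm_ring_hom_at_XY: "comm_ring_hom (at_XY \<eta>)"
  unfolding at_XY_def by (rule comm_ring_hom_subst[OF comm_ring_hom_pCons2])

lemma comm_ring_hom_ev_X: "comm_ring_hom (ev_X \<alpha>)"
  unfolding ev_X_def by (rule comm_ring_hom_subst[OF comm_ring_hom_Const_pCons])

lemma lift_XY_simps:
  "lift_XY (Const c) = [:[:Const c:]:]" "lift_XY (Var 0) = [:0, 1:]" "lift_XY (Var 1) = [:[:0, 1:]:]"
  "lift_XY (Var (Suc 0)) = [:[:0, 1:]:]"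
  "i \<noteq> 0 \<Longrightarrow> i \<noteq> 1 \<Longrightarrow> lift_XY (Var i) = [:[:Var i:]:]"
  by (simp_all add: lift_XY_def subst_Const[OF comm_ring_hom_Const_pCons2]
      subst_Var[OF comm_ring_hom_Const_pCons2])

lemma at_XY_simps:
  "at_XY \<eta> (Const c) = [:[:c:]:]" "at_XY \<eta> (Var 0) = [:0, 1:]" "at_XY \<eta> (Var 1) = [:[:0, 1:]:]"
  "at_XY \<eta> (Var (Suc 0)) = [:[:0, 1:]:]"
  "i \<noteq> 0 \<Longrightarrow> i \<noteq> 1 \<Longrightarrow> at_XY \<eta> (Var i) = [:[:\<eta> i:]:]"
  by (simp_all add: at_XY_def subst_Const[OF comm_ring_hom_pCons2]
      subst_Var[OF comm_ring_hom_pCons2])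

lemma ev_X_simps:
  "ev_X \<alpha> (Const c) = [:Const c:]" "ev_X \<alpha> (Var 0) = \<alpha>" "ev_X \<alpha> (Var 1) = [:0, 1:]"
  "ev_X \<alpha> (Var (Suc 0)) = [:0, 1:]"
  "i \<noteq> 0 \<Longrightarrow> i \<noteq> 1 \<Longrightarrow> ev_X \<alpha> (Var i) = [:Var i:]"
  by (simp_all add: ev_X_def subst_Const[OF comm_ring_hom_Const_pCons]
      subst_Var[OF comm_ring_hom_Const_pCons])

lemma poly_lift_XY: "poly (lift_XY p) \<alpha> = ev_X \<alpha> p"
  unfolding lift_XY_def ev_X_def hom_subst[OF comm_ring_hom_poly]
  by (intro arg_cong2[of _ _ _ _ "\<lambda>h s. subst h s p"] ext) auto

text \<open>Substituting \<alpha> for X commutes with specializing Z, since both sides are the same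
  substitution into \<open>p\<close>.\<close>

lemma poly_at_XY:
  assumes "comm_ring_hom (subst (\<lambda>c. c) \<eta>)"
  shows "poly (at_XY \<eta> p) (map_poly (subst (\<lambda>c. c) \<eta>) \<alpha>) = map_poly (subst (\<lambda>c. c) \<eta>) (ev_X \<alpha> p)"
proof -
  note sub = subst_Const[OF comm_ring_hom_id] subst_Var[OF comm_ring_hom_id]
  interpret comm_ring_hom "subst (\<lambda>c. c) \<eta>" by fact
  show ?thesis
    unfolding at_XY_def ev_X_def hom_subst[OF comm_ring_hom_poly]
      hom_subst[OF comm_ring_hom_map_poly[OF assms]]
    by (intro arg_cong2[of _ _ _ _ "\<lambda>h s. subst h s p"] ext) (auto simp: sub map_poly_const_hom[OF assms])
qed

lemma at_XY_at_Z: "at_XY \<eta> (at_Z \<eta> p) = at_XY \<eta> p"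
  unfolding at_Z_def hom_subst[OF comm_ring_hom_at_XY] at_XY_simps
  by (subst (2) at_XY_def) (intro arg_cong[of _ _ "\<lambda>s. subst _ s p"] ext, auto simp: at_XY_simps)

lemma at_XY_eq_map_poly:
  "at_XY \<eta> p = map_poly (subst (\<lambda>c. [:c:]) (\<lambda>i. if i = 1 then [:0, 1:] else [:\<eta> i:])) (as_poly_in 0 p)"
  unfolding map_poly_as_poly_in[OF comm_ring_hom_pCons_0] at_XY_def
  by (intro arg_cong[of _ _ "\<lambda>s. subst _ s p"] ext) auto

text \<open>Recovers a polynomial in X, Y from its nested form. This later turns a constant nested
  form into a constant polynomial.\<close>

lemma at_XY_inverse:
  assumes "p \<in> mpolys {0, 1}"
  shows "poly (poly (map_poly (map_poly Const) (at_XY \<eta> p)) [:Var 0:]) (Var 1) = p"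
proof -
  have hom: "comm_ring_hom (\<lambda>q. poly (poly (map_poly (map_poly Const) q) [:Var 0:]) (Var 1))"
    by (intro comm_ring_hom_comp[OF comm_ring_hom_poly] comm_ring_hom_comp[OF comm_ring_hom_poly]
        comm_ring_hom_map_poly comm_ring_hom_Const)
  interpret C: comm_ring_hom Const by (rule comm_ring_hom_Const)
  interpret mC: comm_ring_hom "map_poly Const" by (rule comm_ring_hom_map_poly[OF comm_ring_hom_Const])
  have "poly (poly (map_poly (map_poly Const) (at_XY \<eta> p)) [:Var 0:]) (Var 1) = subst Const
    (\<lambda>i. if i = 0 then Var 0 else if i = 1 then Var 1 else Const (\<eta> i)) p"
    unfolding at_XY_def hom_subst[OF hom]
    by (intro arg_cong2[of _ _ _ _ "\<lambda>h s. subst h s p"] ext) 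
      (auto simp: map_poly_const_hom[OF C.comm_ring_hom_axioms] map_poly_const_hom[OF mC.comm_ring_hom_axioms])
  also have "\<dots> = subst Const Var p"
    using assms by (intro subst_cong) auto
  finally show ?thesis by simp
qed

section \<open>Basic properties of \<open>\<chi>\<close>\<close>

lemma map_poly_hom_pCons:
  assumes "comm_ring_hom h"
  shows "map_poly h (pCons a p) = pCons (h a) (map_poly h p)"
proof -
  interpret comm_ring_hom h by fact
  show ?thesis by (rule map_poly_pCons_hom)
qed

lemma poly_map_poly_hom:
  assumes "comm_ring_hom h"
  shows "poly (map_poly h p) (h x) = h (poly p x)"
proof -
  interpret comm_ring_hom h by fact
  show ?thesis by simp
qed

lemma pderiv_map_poly_hom:
  fixes h :: "'a::idom \<Rightarrow> 'b::idom"
  assumes "comm_ring_hom h"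
  shows "pderiv (map_poly h p) = map_poly h (pderiv p)"
  by (rule idom_hom.map_poly_pderiv[symmetric], rule idom_hom.intro, rule assms)

lemma degree_pderiv_le_diff: "Polynomial.degree (pderiv p) \<le> Polynomial.degree p - 1"
  by (intro degree_le allI impI) (simp add: coeff_pderiv coeff_eq_0)

lemma degree_map_poly_eq:
  assumes "comm_ring_hom h" "h (Polynomial.lead_coeff p) \<noteq> 0"
  shows "Polynomial.degree (map_poly h p) = Polynomial.degree p"
    "Polynomial.lead_coeff (map_poly h p) = h (Polynomial.lead_coeff p)"
proof -
  interpret comm_ring_hom h by fact
  have c: "Polynomial.coeff (map_poly h p) (Polynomial.degree p) = h (Polynomial.lead_coeff p)"
    by (simp add: coeff_map_poly)
  with assms(2) have "Polynomial.degree p \<le> Polynomial.degree (map_poly h p)"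
    by (intro le_degree) simp
  then show d: "Polynomial.degree (map_poly h p) = Polynomial.degree p"
    using degree_map_poly_le[of h p] by simp
  show "Polynomial.lead_coeff (map_poly h p) = h (Polynomial.lead_coeff p)"
    using c d by simp
qed

text \<open>\<open>good\<close> is what the nonvanishing of \<Upsilon> provides at the fixed point
  (\<nu>, \<omega>).\<close>

locale good_specialization =
  fixes f :: "(nat, 'k::field) mpoly" and \<nu> \<omega> :: "nat \<Rightarrow> 'k alg_closure" and n \<delta> :: nat
  assumes f_in: "f \<in> mpolys {1..n}"
    and f_deg: "total_degree f = \<delta>"
    and good: "good_point n f \<nu> \<omega>"
begin

abbreviation \<chi> :: "(nat, 'k alg_closure) mpoly" where "\<chi> \<equiv> chi f \<nu> \<omega>"

text \<open>This is \<chi>(X, 0, Z): every term containing some Z_i carries a factor Y. It is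
  therefore univariate over an algebraically closed field.\<close>

definition \<chi>\<^sub>0 :: "'k alg_closure poly" where
  "\<chi>\<^sub>0 = subst (\<lambda>c. [:to_ac c:]) (\<lambda>i. if i = 1 then [:\<nu> 1, 1:] else [:\<nu> i, \<omega> i:]) f"

lemma chi_in: "\<chi> \<in> mpolys (insert 0 (insert 1 {2..n}))"
  and chi_irreducible: "irreducible \<chi>"
proof -
  have "irreducible_in (mpolys ({0, 1} \<union> {2..n})) \<chi>"
    using good by (simp add: good_point_def)
  moreover have "{0, 1} \<union> {2..n} = insert 0 (insert 1 {2..n})"
    by auto
  ultimately have *: "irreducible_in (mpolys (insert 0 (insert 1 {2..n}))) \<chi>"
    by simp
  then show "\<chi> \<in> mpolys (insert 0 (insert 1 {2..n}))"
    by (simp add: irreducible_in_def)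
  from * show "irreducible \<chi>"
    by (rule irreducible_in_imp_irreducible)
qed

lemma chi_lead:
  obtains c where "c \<noteq> 0" "Polynomial.lead_coeff (as_poly_in 0 \<chi>) = Const c"
  using good by (auto simp: good_point_def)

lemma chi_nonzero: "\<chi> \<noteq> 0"
  using chi_irreducible by auto

text \<open>Otherwise \<chi> would equal its leading coefficient in X, a nonzero constant and hence
  a unit.\<close>

lemma deg_in_chi_pos: "0 < deg_in 0 \<chi>"
proof (rule ccontr)
  assume "\<not> 0 < deg_in 0 \<chi>"
  then obtain a where a: "as_poly_in 0 \<chi> = [:a:]"
    by (auto simp: deg_in_def elim: degree_eq_zeroE)
  obtain c where c: "c \<noteq> 0" "Polynomial.lead_coeff (as_poly_in 0 \<chi>) = Const c"
    by (rule chi_lead)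
  have "\<chi> = Const c"
    using poly_as_poly_in[of 0 \<chi>] a c by simp
  then show False
    using chi_irreducible Const_dvd_1[OF c(1)] by (auto simp: irreducible_def)
qed

lemma subst_f_in:
  assumes "filtration F" "\<And>c. h c \<in> F 0" "\<And>i. 1 \<le> i \<Longrightarrow> i \<le> n \<Longrightarrow> s i \<in> F 1"
  shows "subst h s f \<in> F \<delta>"
  by (rule filtration.subst_in[OF assms(1,2) _ f_in]) (use assms(3) f_deg in auto)

text \<open>Z_i enters \<chi> only through its product with Y, so this product as a whole is given
  level 1. This admits filtrations that measure the degree in Z against the power of Y.\<close>

lemma chi_in_filtration:
  assumes F: "filtration F" and "\<And>c. Const c \<in> F 0" "Var 0 \<in> F 1"
    and "\<And>i. 2 \<le> i \<Longrightarrow> i \<le> n \<Longrightarrow> Var i * Var 1 \<in> F 1"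
  shows "\<chi> \<in> F \<delta>"
proof -
  interpret filtration F by fact
  have c1: "Const c \<in> F 1" for c
    using assms(2)[of c] mono_in[of 0 1] by auto
  have "Const c * Var 0 \<in> F 1" for c
    using mult_in[of "Const c" 0 "Var 0" 1] assms by simp
  then show ?thesis
    unfolding chi_def using assms c1
    by (intro subst_f_in[OF F]) (auto intro!: add_in)
qed

lemma deg_in_chi_le: "deg_in 0 \<chi> \<le> \<delta>"
proof -
  have "\<chi> \<in> {p. deg_in 0 p \<le> \<delta>}"
    by (rule chi_in_filtration[OF filtration_deg_in])
      (auto simp: deg_in_def as_poly_in_mult as_poly_in_Var)
  then show ?thesis by simp
qed

lemma filtration_deg_in_coeffs:
  "filtration (\<lambda>k. {p :: (nat, 'k alg_closure) mpoly. \<forall>i. deg_in 1 (Polynomial.coeff (as_poly_in 0 p) i) \<le> k})"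
proof -
  have "filtration (\<lambda>k. {p. \<forall>i. Polynomial.coeff p i \<in> {p :: (nat, 'k alg_closure) mpoly. deg_in 1 p \<le> k}})"
    by (rule filtration.filtration_coeffs[OF filtration_deg_in])
  from filtration.filtration_vimage[OF this comm_ring_hom_as_poly_in[of 0]] show ?thesis
    by simp
qed

lemma deg_in_coeff_chi_le: "deg_in 1 (Polynomial.coeff (as_poly_in 0 \<chi>) i) \<le> \<delta>"
proof -
  have "\<chi> \<in> {p. \<forall>i. deg_in 1 (Polynomial.coeff (as_poly_in 0 p) i) \<le> \<delta>}"
    by (rule chi_in_filtration[OF filtration_deg_in_coeffs])
      (auto simp: deg_in_def as_poly_in_mult as_poly_in_Var coeff_pCons split: nat.splits)
  then show ?thesis by simp
qed

lemma as_poly_in_at_Y_zero_chi: "as_poly_in 0 (at_Y_zero \<chi>) = map_poly Const \<chi>\<^sub>0"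
proof -
  note [simp] = subst_Const[OF comm_ring_hom_Const] subst_Var[OF comm_ring_hom_Const]
  have hom: "comm_ring_hom (\<lambda>p. as_poly_in 0 (at_Y_zero p))"
    unfolding at_Y_zero_def
    by (intro comm_ring_hom_comp[OF comm_ring_hom_as_poly_in] comm_ring_hom_subst comm_ring_hom_Const)
  show ?thesis
    unfolding chi_hom[OF hom] \<chi>\<^sub>0_def hom_subst[OF comm_ring_hom_map_poly[OF comm_ring_hom_Const]]
    by (intro arg_cong2[of _ _ _ _ "\<lambda>h s. subst h s f"] ext)
      (auto simp: at_Y_zero_def as_poly_in_Var map_poly_hom_pCons[OF comm_ring_hom_Const])
qed

lemma map_poly_lift_XY_chi: "map_poly (\<lambda>q. poly q 0) (lift_XY \<chi>) = map_poly Const \<chi>\<^sub>0"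
proof -
  have hom: "comm_ring_hom (\<lambda>p. map_poly (\<lambda>q. poly q 0) (lift_XY p))"
    by (intro comm_ring_hom_comp[OF comm_ring_hom_map_poly[OF comm_ring_hom_poly]] comm_ring_hom_lift_XY)
  show ?thesis
    unfolding chi_hom[OF hom] \<chi>\<^sub>0_def hom_subst[OF comm_ring_hom_map_poly[OF comm_ring_hom_Const]]
    by (intro arg_cong2[of _ _ _ _ "\<lambda>h s. subst h s f"] ext)
      (auto simp: lift_XY_simps map_poly_hom_pCons[OF comm_ring_hom_Const] map_poly_hom_pCons[OF comm_ring_hom_poly])
qed

lemma map_poly_at_XY_chi: "map_poly (\<lambda>q. poly q 0) (at_XY \<eta> \<chi>) = \<chi>\<^sub>0"
proof -
  have hom: "comm_ring_hom (\<lambda>p. map_poly (\<lambda>q. poly q 0) (at_XY \<eta> p))"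
    by (intro comm_ring_hom_comp[OF comm_ring_hom_map_poly[OF comm_ring_hom_poly]] comm_ring_hom_at_XY)
  show ?thesis
    unfolding chi_hom[OF hom] \<chi>\<^sub>0_def
    by (intro arg_cong2[of _ _ _ _ "\<lambda>h s. subst h s f"] ext)
      (auto simp: at_XY_simps map_poly_hom_pCons[OF comm_ring_hom_poly])
qed

text \<open>The leading coefficient in X is a nonzero constant, which no specialization of Z can
  kill.\<close>

lemma at_XY_chi_lead:
  obtains c where "c \<noteq> 0" "Polynomial.lead_coeff (at_XY \<eta> \<chi>) = [:c:]"
    "Polynomial.degree (at_XY \<eta> \<chi>) = deg_in 0 \<chi>"
proof -
  obtain c where c: "c \<noteq> 0" "Polynomial.lead_coeff (as_poly_in 0 \<chi>) = Const c"
    by (rule chi_lead)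
  let ?h = "subst (\<lambda>c. [:c:]) (\<lambda>i. if i = 1 then [:0, 1:] else [:\<eta> i:])"
  have hom: "comm_ring_hom ?h"
    by (rule comm_ring_hom_subst[OF comm_ring_hom_pCons_0])
  have "?h (Polynomial.lead_coeff (as_poly_in 0 \<chi>)) = [:c:]"
    unfolding c by (rule subst_Const[OF comm_ring_hom_pCons_0])
  then show ?thesis
    using degree_map_poly_eq[OF hom, of "as_poly_in 0 \<chi>"] c that[of c]
    by (simp add: at_XY_eq_map_poly deg_in_def)
qed

lemma degree_chi0: "Polynomial.degree \<chi>\<^sub>0 = deg_in 0 \<chi>"
proof -
  obtain c where c: "c \<noteq> 0" "Polynomial.lead_coeff (at_XY (\<lambda>_. 0) \<chi>) = [:c:]"
    "Polynomial.degree (at_XY (\<lambda>_. 0) \<chi>) = deg_in 0 \<chi>"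
    by (rule at_XY_chi_lead)
  have "poly (Polynomial.lead_coeff (at_XY (\<lambda>_. 0) \<chi>)) 0 \<noteq> 0"
    unfolding c using c by simp
  from degree_map_poly_eq(1)[OF comm_ring_hom_poly this] show ?thesis
    by (simp add: map_poly_at_XY_chi c)
qed

lemma chi0_nonzero: "\<chi>\<^sub>0 \<noteq> 0"
  using degree_chi0 deg_in_chi_pos by auto

text \<open>A multiple root is a common zero of \<open>\<chi>\<^sub>0\<close> and its derivative.
  Their resultant lies in the ideal they generate, so it would vanish, and the discriminant with
  it.\<close>

lemma chi0_simple_root:
  assumes "poly \<chi>\<^sub>0 x = 0"
  shows "poly (pderiv \<chi>\<^sub>0) x \<noteq> 0"
proof
  assume der: "poly (pderiv \<chi>\<^sub>0) x = 0"
  define p where "p = (map_poly Const \<chi>\<^sub>0 :: (nat, 'k alg_closure) mpoly poly)"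
  have lead: "(Const (Polynomial.lead_coeff \<chi>\<^sub>0) :: (nat, 'k alg_closure) mpoly) \<noteq> 0"
    using chi0_nonzero by simp
  have deg: "Polynomial.degree p = deg_in 0 \<chi>"
    using degree_map_poly_eq(1)[OF comm_ring_hom_Const lead] by (simp add: p_def degree_chi0)
  then have pos: "1 \<le> Polynomial.degree p"
    using deg_in_chi_pos by simp
  have p': "pderiv p = map_poly Const (pderiv \<chi>\<^sub>0)"
    unfolding p_def by (rule pderiv_map_poly_hom[OF comm_ring_hom_Const])
  let ?d = "Polynomial.degree p"
  obtain u v where "resultant_sub ?d (?d - 1) p (pderiv p) =
      u * poly p (Const x) + v * poly (pderiv p) (Const x)"
    using resultant_sub_in_ideal[OF order.refl degree_pderiv_le_diff, of p p "Const x"] pos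
    by auto
  moreover have "poly p (Const x) = 0" "poly (pderiv p) (Const x) = 0"
    using assms der unfolding p' unfolding p_def by (simp_all add: poly_map_poly_hom[OF comm_ring_hom_Const])
  ultimately have "Polynomial.lead_coeff p * discriminant p = 0"
    using lead_coeff_times_discriminant[OF pos] by simp
  then have "discriminant p = 0"
    using pos by auto
  moreover have "discriminant p \<noteq> 0"
    using good by (simp add: good_point_def p_def as_poly_in_at_Y_zero_chi)
  ultimately show False by simp
qed

end

section \<open>Power series roots and small relations\<close>

context good_specialization
begin

text \<open>Newton iteration with the slope frozen at its starting value; each step gains one power
  of Y. All iterates stay in the subring \<open>?W\<close> of graded coefficients.\<close>

lemma newton_lift:
  assumes root: "poly \<chi>\<^sub>0 x = 0"
  obtains \<alpha> where "\<And>k. Polynomial.coeff \<alpha> k \<in> mpolys {2..n}"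
    "\<And>k. total_degree (Polynomial.coeff \<alpha> k) \<le> k"
    "Polynomial.coeff \<alpha> 0 = Const x" "Polynomial.monom 1 (Suc K) dvd ev_X \<alpha> \<chi>"
proof -
  let ?F = "\<lambda>k. {p :: (nat, 'k alg_closure) mpoly. p \<in> mpolys {2..n} \<and> total_degree p \<le> k}"
  interpret F: filtration ?F by (rule filtration_mpolys_total_degree)
  interpret W: filtration "\<lambda>_. {p. \<forall>i. Polynomial.coeff p i \<in> ?F i}"
    by (rule F.filtration_graded_coeffs)
  let ?W = "{p. \<forall>i. Polynomial.coeff p i \<in> ?F i}"
  have const_W: "[:Const c:] \<in> ?W" for c
    using F.zero_in by (auto simp: coeff_pCons split: nat.splits)
  have Var_W: "[:0, Var i:] \<in> ?W" if "2 \<le> i" "i \<le> n" for i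
    using that F.zero_in by (auto simp: coeff_pCons total_degree_Var split: nat.splits)
  have ev_W: "ev_X \<alpha> \<chi> \<in> ?W" if "\<alpha> \<in> ?W" for \<alpha>
  proof -
    interpret ev: comm_ring_hom "ev_X \<alpha>" by (rule comm_ring_hom_ev_X)
    have "\<chi> \<in> {p. ev_X \<alpha> p \<in> ?W}"
    proof (rule chi_in_filtration[OF W.filtration_vimage[OF comm_ring_hom_ev_X]])
      fix i assume i: "2 \<le> i" "i \<le> n"
      then have "ev_X \<alpha> (Var i * Var 1) = [:0, Var i:]"
        by (simp add: ev.hom_mult ev_X_simps)
      then show "Var i * Var 1 \<in> {p. ev_X \<alpha> p \<in> ?W}"
        using Var_W[OF i] by simp
    qed (use that const_W in \<open>auto simp: ev_X_simps\<close>)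
    then show ?thesis by simp
  qed
  define d where "d = poly (pderiv \<chi>\<^sub>0) x"
  have d: "d \<noteq> 0"
    unfolding d_def by (rule chi0_simple_root[OF root])
  let ?P = "lift_XY \<chi>" and ?x = "Const x :: (nat, 'k alg_closure) mpoly"
  \<comment> \<open>Setting Y = 0 turns \<open>?P\<close> into \<open>\<chi>\<^sub>0\<close> and
    \<alpha> into \<open>x\<close>.\<close>
  have eval_0: "Polynomial.coeff (poly ?P \<alpha>) 0 = 0"
    and eval_0': "Polynomial.coeff (poly (pderiv ?P) \<alpha>) 0 = Const d"
    if "Polynomial.coeff \<alpha> 0 = ?x" for \<alpha>
  proof -
    have \<alpha>: "poly \<alpha> 0 = ?x"
      using that by (simp add: poly_0_coeff_0)
    have "poly (poly ?P \<alpha>) 0 = poly (map_poly (\<lambda>q. poly q 0) ?P) ?x"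
      using poly_map_poly_hom[OF comm_ring_hom_poly, of 0 ?P \<alpha>, symmetric] by (simp only: \<alpha>)
    also have "\<dots> = 0"
      using root by (simp only: map_poly_lift_XY_chi poly_map_poly_hom[OF comm_ring_hom_Const] Const_0)
    finally show "Polynomial.coeff (poly ?P \<alpha>) 0 = 0"
      by (simp only: poly_0_coeff_0)
    have "poly (poly (pderiv ?P) \<alpha>) 0 = poly (map_poly (\<lambda>q. poly q 0) (pderiv ?P)) ?x"
      using poly_map_poly_hom[OF comm_ring_hom_poly, of 0 "pderiv ?P" \<alpha>, symmetric]
      by (simp only: \<alpha>)
    also have "\<dots> = Const d"
      unfolding pderiv_map_poly_hom[OF comm_ring_hom_poly, symmetric] map_poly_lift_XY_chi
        pderiv_map_poly_hom[OF comm_ring_hom_Const] poly_map_poly_hom[OF comm_ring_hom_Const] d_def ..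
    finally show "Polynomial.coeff (poly (pderiv ?P) \<alpha>) 0 = Const d"
      by (simp only: poly_0_coeff_0)
  qed
  have "\<exists>\<alpha>\<in>?W. Polynomial.coeff \<alpha> 0 = ?x \<and> Polynomial.monom 1 (Suc K) dvd ev_X \<alpha> \<chi>"
  proof (induction K)
    case 0
    have "Polynomial.monom 1 1 dvd poly ?P [:?x:]"
      using eval_0[of "[:?x:]"] by (simp add: monom_1_dvd_iff')
    then show ?case
      using const_W by (intro bexI[of _ "[:?x:]"]) (auto simp: poly_lift_XY)
  next
    case (Suc K)
    then obtain \<alpha> where \<alpha>: "\<alpha> \<in> ?W" "Polynomial.coeff \<alpha> 0 = ?x"
      "Polynomial.monom 1 (Suc K) dvd ev_X \<alpha> \<chi>"
      by blast
    \<comment> \<open>The slope \<open>d\<close> is a nonzero field element, so dividing by it does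
      not raise the degree in Z.\<close>
    define c where "c = [:Const (inverse d) :: (nat, 'k alg_closure) mpoly:]"
    define E where "E = ev_X \<alpha> \<chi>"
    define \<beta> where "\<beta> = \<alpha> + (- c * E)"
    have "- c * E \<in> ?W"
      using W.mult_in[OF W.uminus_in[OF const_W] ev_W[OF \<alpha>(1)]] by (simp add: c_def E_def)
    then have \<beta>_W: "\<beta> \<in> ?W"
      unfolding \<beta>_def using W.add_in[OF \<alpha>(1)] by blast
    have E_0: "Polynomial.coeff E 0 = 0"
      using eval_0[OF \<alpha>(2)] by (simp add: E_def poly_lift_XY)
    then have \<beta>_0: "Polynomial.coeff \<beta> 0 = ?x"
      using \<alpha>(2) by (simp add: \<beta>_def coeff_mult_0)
    obtain r where r: "poly ?P \<beta> = poly ?P \<alpha> + (- c * E) * poly (pderiv ?P) \<alpha> + (- c * E)\<^sup>2 * r"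
      unfolding \<beta>_def by (rule poly_taylor2)
    \<comment> \<open>Both terms are \<open>E\<close> times a multiple of Y, hence the gain of one
      power.\<close>
    have eq: "ev_X \<beta> \<chi> = E * (1 - c * poly (pderiv ?P) \<alpha>) + E * E * (c\<^sup>2 * r)"
      using r by (simp add: poly_lift_XY E_def power2_eq_square algebra_simps)
    have "Const (inverse d) * Const d = (1 :: (nat, 'k alg_closure) mpoly)"
      using d by (simp add: Const_def mult_single)
    then have "Polynomial.coeff (1 - c * poly (pderiv ?P) \<alpha>) 0 = 0"
      using eval_0'[OF \<alpha>(2)] by (simp add: coeff_mult_0 c_def)
    then have y: "Polynomial.monom 1 1 dvd 1 - c * poly (pderiv ?P) \<alpha>" "Polynomial.monom 1 1 dvd E"
      using E_0 by (simp_all add: monom_1_dvd_iff')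
    have mon: "Polynomial.monom 1 (Suc (Suc K)) =
        Polynomial.monom 1 (Suc K) * (Polynomial.monom 1 1 :: (nat, 'k alg_closure) mpoly poly)"
      by (simp add: mult_monom)
    have "Polynomial.monom 1 (Suc (Suc K)) dvd ev_X \<beta> \<chi>"
      unfolding eq mon using \<alpha>(3) y by (intro dvd_add mult_dvd_mono dvd_mult2) (auto simp: E_def)
    then show ?case
      using \<beta>_W \<beta>_0 by blast
  qed
  then show ?thesis
    using that by blast
qed

end

text \<open>The coefficient of \<open>t\<^bsup>k\<^esup>\<close> in \<open>XY_graded p\<close> is the part of \<open>p\<close> of degree \<open>k\<close> in \<open>X, Y\<close>.\<close>

definition XY_graded :: "(nat, 'a::comm_ring_1) mpoly \<Rightarrow> (nat, 'a) mpoly poly" where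
  "XY_graded = subst (\<lambda>c. [:Const c:])
     (\<lambda>i. if i = 0 then [:0, Var 0:] else if i = 1 then [:0, Var 1:] else [:Var i:])"

lemma comm_ring_hom_XY_graded: "comm_ring_hom XY_graded"
  unfolding XY_graded_def by (rule comm_ring_hom_subst[OF comm_ring_hom_Const_pCons])

lemma poly_XY_graded: "poly (XY_graded p) 1 = (p :: (nat, 'a::comm_ring_1) mpoly)"
proof -
  have "poly (XY_graded p) 1 = subst Const Var p"
    unfolding XY_graded_def hom_subst[OF comm_ring_hom_poly]
    by (intro arg_cong2[of _ _ _ _ "\<lambda>h s. subst h s p"] ext) auto
  then show ?thesis by simp
qed

lemma XY_graded_Var: "XY_graded (Var 0) = [:0, Var 0:]" "XY_graded (Var (Suc 0)) = [:0, Var (Suc 0):]"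
  by (simp_all add: XY_graded_def subst_Var[OF comm_ring_hom_Const_pCons])

lemma subst_free:
  assumes "comm_ring_hom \<phi>" "p \<in> mpolys V" "\<And>c. h c = \<phi> (Const c)" "\<And>i. i \<in> V \<Longrightarrow> s i = \<phi> (Var i)"
  shows "subst h s p = \<phi> (p :: ('v, 'a::comm_ring_1) mpoly)"
proof -
  have "h = (\<lambda>c. \<phi> (Const c))"
    using assms(3) by (rule ext)
  then have "subst h s p = subst (\<lambda>c. \<phi> (Const c)) (\<lambda>i. \<phi> (Var i)) p"
    using subst_cong[OF assms(2,4)] by simp
  also have "\<dots> = \<phi> (subst Const Var p)"
    by (rule hom_subst[OF assms(1), symmetric])
  finally show ?thesis by simp
qed

lemma ev_X_free: "p \<in> mpolys {2..n} \<Longrightarrow> ev_X \<alpha> p = [:p:]"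
  unfolding ev_X_def by (rule subst_free[OF comm_ring_hom_pCons_0]) auto

lemma lift_XY_free: "p \<in> mpolys {2..n} \<Longrightarrow> lift_XY p = [:[:p:]:]"
  unfolding lift_XY_def by (rule subst_free[OF comm_ring_hom_pCons2]) auto

lemma XY_graded_free: "p \<in> mpolys {2..n} \<Longrightarrow> XY_graded p = [:p:]"
  unfolding XY_graded_def by (rule subst_free[OF comm_ring_hom_pCons_0]) auto

text \<open>Polynomials free of X ignore \<alpha>, so divisibility by a power of Y can be read from
  their own expansion in Y.\<close>

lemma ev_X_eq_as_poly_in:
  assumes "p \<in> mpolys (insert 1 {2..n})"
  shows "ev_X \<alpha> p = as_poly_in 1 p"
  unfolding ev_X_def using assms
  by (rule subst_free[OF comm_ring_hom_as_poly_in]) (auto simp: as_poly_in_Var)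

context good_specialization
begin

text \<open>A homomorphism on the coefficients cannot raise the degree in t, so one may be applied
  first. The one chosen turns the coefficient of t^\<delta> into the top homogeneous part of
  \<open>f\<close>, where distinct monomials cannot cancel.\<close>

lemma degree_XY_graded_chi:
  assumes "0 < \<delta>"
  shows "\<delta> \<le> Polynomial.degree (XY_graded \<chi>)"
proof -
  \<comment> \<open>After this substitution \<open>XY_graded \<chi>\<close> becomes \<open>f(\<nu>\<^sub>1 + t X\<^sub>1, \<dots>, \<nu>\<^sub>n + t X\<^sub>n)\<close>.\<close>
  let ?\<kappa>\<^sub>0 = "subst Const (\<lambda>i. if i = 0 then Var 1 else if i = 1 then 1
    else Var i - Const (\<omega> i) * Var 1) :: (nat, 'k alg_closure) mpoly \<Rightarrow> _"
  let ?\<kappa> = "\<lambda>p. map_poly ?\<kappa>\<^sub>0 (XY_graded p)"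
  note sub = subst_Const[OF comm_ring_hom_Const] subst_Var[OF comm_ring_hom_Const]
  have hom0: "comm_ring_hom ?\<kappa>\<^sub>0"
    by (rule comm_ring_hom_subst[OF comm_ring_hom_Const])
  interpret hom0: comm_ring_hom ?\<kappa>\<^sub>0 by (rule hom0)
  have hom: "comm_ring_hom ?\<kappa>"
    by (rule comm_ring_hom_comp[OF comm_ring_hom_map_poly[OF hom0] comm_ring_hom_XY_graded])
  have \<kappa>_Const: "?\<kappa> (Const c) = [:Const c:]" for c
    by (simp add: XY_graded_def subst_Const[OF comm_ring_hom_Const_pCons]
        map_poly_hom_pCons[OF hom0] sub)
  have \<kappa>_Var: "?\<kappa> (Var i) = (if i = 0 then [:0, Var 1:] else if i = 1 then [:0, 1:]
    else [:Var i - Const (\<omega> i) * Var 1:])" for i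
    by (simp add: XY_graded_def subst_Var[OF comm_ring_hom_Const_pCons]
        map_poly_hom_pCons[OF hom0] sub)
  have "?\<kappa> \<chi> = subst (\<lambda>c. [:Const (to_ac c):]) (\<lambda>i. [:Const (\<nu> i), Var i:]) f"
    unfolding chi_hom[OF hom] \<kappa>_Const using f_in
    by (rule subst_cong) (auto simp: \<kappa>_Var algebra_simps)
  then have \<kappa>: "?\<kappa> \<chi> = (\<Sum>m\<in>Poly_Mapping.keys f. [:Const (to_ac (Poly_Mapping.lookup f m)):] *
      mon_eval (\<lambda>i. [:Const (\<nu> i), Var i:]) m)"
    by (simp add: subst_eq_mon_eval)
  have term_coeff: "Polynomial.coeff (mon_eval (\<lambda>i. [:Const (\<nu> i), Var i:]) m) \<delta> =
      (if monom_degree m = \<delta> then Poly_Mapping.single m 1 else 0)" if "m \<in> Poly_Mapping.keys f" for m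
  proof (cases "monom_degree m = \<delta>")
    case True
    then show ?thesis
      using mon_eval_linear_top(2)[of "\<lambda>i. Const (\<nu> i)" Var m] by (simp add: mon_eval_Var)
  next
    case False
    have "monom_degree m \<le> \<delta>"
      using that f_deg total_degree_le_iff[of f \<delta>] by simp
    then have "Polynomial.degree (mon_eval (\<lambda>i. [:Const (\<nu> i), Var i:]) m) < \<delta>"
      using mon_eval_linear_top(1)[of "\<lambda>i. Const (\<nu> i)" Var m] False by simp
    then show ?thesis
      using False by (simp add: coeff_eq_0)
  qed
  have "\<exists>m\<in>Poly_Mapping.keys f. monom_degree m = \<delta>"
  proof (rule ccontr)
    assume "\<not> ?thesis"
    then have "total_degree f \<le> \<delta> - 1"
      unfolding total_degree_le_iff using f_deg total_degree_le_iff[of f \<delta>] by fastforce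
    then show False
      using f_deg assms by simp
  qed
  then obtain m\<^sub>0 where m\<^sub>0: "m\<^sub>0 \<in> Poly_Mapping.keys f" "monom_degree m\<^sub>0 = \<delta>"
    by blast
  have "Polynomial.coeff (?\<kappa> \<chi>) \<delta> = (\<Sum>m\<in>Poly_Mapping.keys f.
      if monom_degree m = \<delta> then Poly_Mapping.single m (to_ac (Poly_Mapping.lookup f m)) else 0)"
    unfolding \<kappa> Polynomial.coeff_sum
    by (intro sum.cong) (auto simp: term_coeff Const_mult_single)
  also have "Poly_Mapping.lookup \<dots> m\<^sub>0 = (\<Sum>m\<in>Poly_Mapping.keys f.
      if m = m\<^sub>0 then to_ac (Poly_Mapping.lookup f m\<^sub>0) else 0)"
    unfolding lookup_sum using m\<^sub>0 by (intro sum.cong) (auto simp: lookup_single when_def)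
  also have "\<dots> = to_ac (Poly_Mapping.lookup f m\<^sub>0)"
    using m\<^sub>0 by simp
  also have "\<dots> \<noteq> 0"
    using m\<^sub>0 by (simp add: in_keys_iff)
  finally have "Polynomial.coeff (?\<kappa> \<chi>) \<delta> \<noteq> 0"
    by auto
  then have "\<delta> \<le> Polynomial.degree (?\<kappa> \<chi>)"
    by (rule le_degree)
  also have "\<dots> \<le> Polynomial.degree (XY_graded \<chi>)"
    by (rule degree_map_poly_le)
  finally show ?thesis .
qed

text \<open>The separate degree bounds in X and Y keep the Y-degree of the resultant below the
  precision 2D\<delta> + 1. The joint bound then excludes that \<chi> divides a nonzero
  \<open>h\<close>.\<close>

lemma no_small_relation:
  assumes D: "D < \<delta>"
    and \<alpha>: "Polynomial.monom 1 (Suc (2 * D * \<delta>)) dvd ev_X \<alpha> \<chi>"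
      "Polynomial.monom 1 (Suc (2 * D * \<delta>)) dvd ev_X \<alpha> h"
    and h: "h \<in> mpolys (insert 0 (insert 1 {2..n}))" "deg_in 0 h \<le> D"
      "\<And>i. deg_in 1 (Polynomial.coeff (as_poly_in 0 h) i) \<le> D"
      "Polynomial.degree (XY_graded h) \<le> D"
  shows "h = 0"
proof (rule ccontr)
  assume "h \<noteq> 0"
  let ?P = "as_poly_in 0 \<chi>" and ?H = "as_poly_in 0 h"
  let ?S = "mpolys (insert 1 {2..n}) :: (nat, 'k alg_closure) mpoly set"
  define d e where "d = Polynomial.degree ?P" and "e = Polynomial.degree ?H"
  have d: "0 < d" "d \<le> \<delta>" and e: "e \<le> D"
    using deg_in_chi_pos deg_in_chi_le h by (simp_all add: d_def e_def deg_in_def)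
  have free: "insert 0 (insert 1 {2..n}) - {0} = insert 1 {2..n}"
    by auto
  have coeffs: "Polynomial.coeff ?P i \<in> ?S" "Polynomial.coeff ?H i \<in> ?S" for i
    using coeff_as_poly_in_mpolys[OF chi_in, of 0 i] coeff_as_poly_in_mpolys[OF h(1), of 0 i]
    unfolding free by simp_all
  interpret S: filtration "\<lambda>_. ?S" by (rule filtration_mpolys)
  interpret Y: filtration "\<lambda>k. {p :: (nat, 'k alg_closure) mpoly. deg_in 1 p \<le> k}"
    by (rule filtration_deg_in)
  let ?A = "sylvester_mat_sub d e ?P ?H"
  define R where "R = resultant ?P ?H"
  have R: "R = resultant_sub d e ?P ?H"
    by (simp add: R_def resultant_sub d_def e_def)
  have "det ?A \<in> ?S"
    by (rule S.det_in[OF sylvester_mat_sub_carrier])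
      (use coeffs S.zero_in in \<open>auto simp: sylvester_mat_sub_index\<close>)
  then have R_S: "R \<in> ?S"
    by (simp add: R resultant_sub_def)
  \<comment> \<open>The \<open>e\<close> rows built from \<chi> have Y-degree at most \<delta>, the
    \<open>d\<close> rows built from \<open>h\<close> at most D.\<close>
  have "det ?A \<in> {p. deg_in 1 p \<le> (\<Sum>i<d + e. if i < e then \<delta> else D)}"
    by (rule Y.det_in[OF sylvester_mat_sub_carrier])
      (use deg_in_coeff_chi_le h(3) Y.zero_in in \<open>auto simp: sylvester_mat_sub_index\<close>)
  also have "(\<Sum>i<d + e. if i < e then \<delta> else D) = e * \<delta> + d * D"
  proof -
    have "{..<d + e} \<inter> {i. i < e} = {..<e}" "{..<d + e} \<inter> - {i. i < e} = {e..<d + e}"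
      by auto
    then show ?thesis
      by (simp add: sum.If_cases)
  qed
  finally have "deg_in 1 R \<le> e * \<delta> + d * D"
    by (simp add: R resultant_sub_def)
  also have "\<dots> \<le> D * \<delta> + \<delta> * D"
    using d e by (intro add_mono mult_mono) auto
  finally have R_Y: "deg_in 1 R \<le> 2 * D * \<delta>"
    by (simp add: algebra_simps)
  interpret ev: comm_ring_hom "ev_X \<alpha>" by (rule comm_ring_hom_ev_X)
  obtain u v where "R = u * poly ?P (Var 0) + v * poly ?H (Var 0)"
    unfolding R by (rule resultant_sub_in_ideal[of ?P d ?H e "Var 0"]) (use d in \<open>auto simp: d_def e_def\<close>)
  then have "ev_X \<alpha> R = ev_X \<alpha> u * ev_X \<alpha> \<chi> + ev_X \<alpha> v * ev_X \<alpha> h"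
    by (simp add: ev.hom_add ev.hom_mult)
  then have "Polynomial.monom 1 (Suc (2 * D * \<delta>)) dvd ev_X \<alpha> R"
    using \<alpha> by simp
  then have dvd: "Polynomial.monom 1 (Suc (2 * D * \<delta>)) dvd as_poly_in 1 R"
    unfolding ev_X_eq_as_poly_in[OF R_S] .
  \<comment> \<open>Coefficients up to 2D\<delta> vanish by divisibility, those beyond by the degree
    bound.\<close>
  have "as_poly_in 1 R = 0"
  proof (rule poly_eqI)
    fix k show "Polynomial.coeff (as_poly_in 1 R) k = Polynomial.coeff 0 k"
      using dvd R_Y by (cases "k \<le> 2 * D * \<delta>") (auto simp: monom_1_dvd_iff' deg_in_def coeff_eq_0)
  qed
  then have "resultant ?P ?H = 0"
    by (simp add: R_def)
  then obtain a b where ab: "a * ?P + b * ?H = 0" "b \<noteq> 0" "Polynomial.degree b < Polynomial.degree ?P"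
    "\<And>i. Polynomial.coeff a i \<in> ?S" "\<And>i. Polynomial.coeff b i \<in> ?S"
    using chi_nonzero by (elim resultant_eq_0_relation[OF filtration_mpolys _ coeffs]) auto
  \<comment> \<open>This cofactor of \<open>h\<close> has smaller X-degree than \<chi>, so \<chi>
    cannot divide it once it is nonzero.\<close>
  define w where "w = poly b (Var 0)"
  have b: "as_poly_in 0 w = b"
    unfolding w_def by (rule as_poly_in_poly[OF ab(5)]) auto
  have w: "w \<noteq> 0"
    using b ab(2) by auto
  have "w \<in> mpolys (insert 0 (insert 1 {2..n}))"
  proof -
    interpret C: filtration "\<lambda>_. mpolys (insert 0 (insert 1 {2..n})) :: (nat, 'k alg_closure) mpoly set"
      by (rule filtration_mpolys)
    show ?thesis
      unfolding w_def poly_altdef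
      by (intro C.sum_in C.mult_in C.power_in mpolys_mono[OF _ ab(5)]) auto
  qed
  moreover have "\<chi> dvd w * h"
  proof -
    have "poly a (Var 0) * \<chi> + w * h = 0"
      using arg_cong[OF ab(1), of "\<lambda>p. poly p (Var 0)"] by (simp add: w_def)
    then have "w * h = \<chi> * (- poly a (Var 0))"
      by (simp add: eq_neg_iff_add_eq_0 add.commute mult.commute)
    then show ?thesis by simp
  qed
  ultimately have "\<chi> dvd w \<or> \<chi> dvd h"
    using irreducible_imp_prime_mpolys[OF _ chi_in chi_irreducible _ h(1)] by simp
  then show False
  proof
    assume "\<chi> dvd w"
    then obtain q where q: "w = \<chi> * q" ..
    then have "deg_in 0 w = deg_in 0 \<chi> + deg_in 0 q"
      using w by (auto intro: deg_in_mult)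
    then show False
      using ab(3) b by (simp add: deg_in_def)
  next
    assume "\<chi> dvd h"
    then obtain q where q: "h = \<chi> * q" ..
    interpret g: comm_ring_hom "XY_graded :: (nat, 'k alg_closure) mpoly \<Rightarrow> _"
      by (rule comm_ring_hom_XY_graded)
    have nz: "XY_graded p \<noteq> 0" if "p \<noteq> 0" for p :: "(nat, 'k alg_closure) mpoly"
      using that poly_XY_graded[of p] by auto
    \<comment> \<open>The joint degree in X, Y is additive, so a nonzero multiple of \<chi> has
      degree at least \<delta>, which exceeds D.\<close>
    have "Polynomial.degree (XY_graded h) = Polynomial.degree (XY_graded \<chi>) + Polynomial.degree (XY_graded q)"
      unfolding q g.hom_mult using q \<open>h \<noteq> 0\<close> nz by (intro degree_mult_eq) auto
    then show False
      using degree_XY_graded_chi D h(4) by simp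
  qed
qed

end

section \<open>Factors of the specialization\<close>

lemma single_eq_iff_XY:
  "Poly_Mapping.single (0::nat) a + Poly_Mapping.single 1 b =
    (Poly_Mapping.single 0 a' + Poly_Mapping.single 1 b' :: nat \<Rightarrow>\<^sub>0 nat) \<longleftrightarrow> a = a' \<and> b = b'"
proof
  assume eq: "Poly_Mapping.single (0::nat) a + Poly_Mapping.single 1 b =
    (Poly_Mapping.single 0 a' + Poly_Mapping.single 1 b' :: nat \<Rightarrow>\<^sub>0 nat)"
  show "a = a' \<and> b = b'"
    using arg_cong[OF eq, of "\<lambda>m. Poly_Mapping.lookup m 0"]
      arg_cong[OF eq, of "\<lambda>m. Poly_Mapping.lookup m 1"]
    by (simp add: lookup_add lookup_single when_def)
qed simp

lemma monomial_XY:
  assumes "Poly_Mapping.keys m \<subseteq> {0, 1::nat}"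
  shows "m = Poly_Mapping.single 0 (Poly_Mapping.lookup m 0) + Poly_Mapping.single 1 (Poly_Mapping.lookup m 1)"
    and "monom_degree m = Poly_Mapping.lookup m 0 + Poly_Mapping.lookup m 1"
proof -
  show "m = Poly_Mapping.single 0 (Poly_Mapping.lookup m 0) + Poly_Mapping.single 1 (Poly_Mapping.lookup m 1)"
  proof (rule poly_mapping_eqI)
    fix i
    have "Poly_Mapping.lookup m i = 0" if "i \<notin> {0, 1}"
      using assms that by (auto simp: in_keys_iff)
    then show "Poly_Mapping.lookup m i = Poly_Mapping.lookup
      (Poly_Mapping.single 0 (Poly_Mapping.lookup m 0) + Poly_Mapping.single 1 (Poly_Mapping.lookup m 1)) i"
      by (cases "i = 0"; cases "i = 1") (auto simp: lookup_add lookup_single when_def)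
  qed
  show "monom_degree m = Poly_Mapping.lookup m 0 + Poly_Mapping.lookup m 1"
    using monom_degree_superset[OF _ assms] by simp
qed

text \<open>Writes the value of \<open>h\<close> at \<beta> as a linear expression in its
  coefficients; \<open>e\<close> enumerates the exponent pairs that serve as column indices.\<close>

lemma poly_at_XY_eq_sum:
  fixes h :: "(nat, 'a::comm_ring_1) mpoly" and N :: nat
  assumes e: "bij_betw e {..<N} {(a, b). a + b \<le> D}"
    and h: "h \<in> mpolys {0, 1}" "total_degree h \<le> D"
  defines "c \<equiv> \<lambda>j. Poly_Mapping.lookup h
    (Poly_Mapping.single 0 (fst (e j)) + Poly_Mapping.single 1 (snd (e j)))"
  shows "poly (at_XY \<eta> h) \<beta> = (\<Sum>j<N. smult (c j) (\<beta> ^ fst (e j) * Polynomial.monom 1 (snd (e j))))"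
    and "h \<noteq> 0 \<Longrightarrow> \<exists>j<N. c j \<noteq> 0"
proof -
  define mon where "mon j = (Poly_Mapping.single 0 (fst (e j)) + Poly_Mapping.single 1 (snd (e j)) :: nat \<Rightarrow>\<^sub>0 nat)" for j
  have inj: "inj_on mon {..<N}"
    using bij_betw_imp_inj_on[OF e]
    by (auto simp: inj_on_def mon_def single_eq_iff_XY prod_eq_iff simp del: One_nat_def)
  have keys: "Poly_Mapping.keys h \<subseteq> mon ` {..<N}"
  proof
    fix m assume m: "m \<in> Poly_Mapping.keys h"
    then have sub: "Poly_Mapping.keys m \<subseteq> {0, 1}" and "monom_degree m \<le> D"
      using h by (auto simp: mpolys_def total_degree_le_iff)
    then have "(Poly_Mapping.lookup m 0, Poly_Mapping.lookup m 1) \<in> e ` {..<N}"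
      unfolding bij_betw_imp_surj_on[OF e] by (simp add: monomial_XY(2))
    then obtain j where j: "(Poly_Mapping.lookup m 0, Poly_Mapping.lookup m 1) = e j" "j \<in> {..<N}"
      by (rule imageE)
    have "m = mon j"
      using monomial_XY(1)[OF sub] by (simp add: mon_def j(1)[symmetric])
    with j(2) show "m \<in> mon ` {..<N}"
      by blast
  qed
  let ?s = "\<lambda>i. if i = 0 then [:0, 1:] else if i = 1 then [:[:0, 1:]:] else [:[:\<eta> i:]:]"
  have "at_XY \<eta> h = (\<Sum>m\<in>mon ` {..<N}. [:[:Poly_Mapping.lookup h m:]:] * mon_eval ?s m)"
    unfolding at_XY_def using keys by (intro subst_superset) auto
  also have "\<dots> = (\<Sum>j<N. [:[:c j:]:] * ([:0, 1:] ^ fst (e j) * [:[:0, 1:]:] ^ snd (e j)))"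
    unfolding sum.reindex[OF inj] by (simp add: mon_def c_def mon_eval_add mon_eval_single)
  finally have "poly (at_XY \<eta> h) \<beta> = (\<Sum>j<N. [:c j:] * (\<beta> ^ fst (e j) * [:0, 1:] ^ snd (e j)))"
    by (simp add: poly_sum)
  then show "poly (at_XY \<eta> h) \<beta> = (\<Sum>j<N. smult (c j) (\<beta> ^ fst (e j) * Polynomial.monom 1 (snd (e j))))"
    by (simp add: monom_altdef)
  assume "h \<noteq> 0"
  then obtain m where "m \<in> Poly_Mapping.keys h"
    using poly_mapping_eqI[of h 0] by (auto simp: in_keys_iff)
  then show "\<exists>j<N. c j \<noteq> 0"
    using keys by (auto simp: c_def mon_def in_keys_iff)
qed

context good_specialization
begin

text \<open>Quantifying over all lifts \<alpha> of \<open>x\<close> and all precisions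
  \<open>K\<close> makes the property independent of the lift from which a minor is built.\<close>

definition vanishes_along :: "(nat \<Rightarrow> 'k alg_closure) \<Rightarrow> (nat, 'k alg_closure) mpoly \<Rightarrow> 'k alg_closure \<Rightarrow> bool" where
  "vanishes_along \<eta> h x \<longleftrightarrow> (\<forall>\<alpha> K k. Polynomial.coeff \<alpha> 0 = Const x \<longrightarrow>
     Polynomial.monom 1 (Suc K) dvd ev_X \<alpha> \<chi> \<longrightarrow> k \<le> K \<longrightarrow>
     Polynomial.coeff (poly (at_XY \<eta> h) (map_poly (subst (\<lambda>c. c) \<eta>) \<alpha>)) k = 0)"

text \<open>Since \<open>x\<close> is a simple root of \<open>\<chi>\<^sub>0\<close>, the cofactor
  of \<open>h\<close> does not vanish there. Its value along the specialized lift has nonzero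
  constant term and can be cancelled modulo powers of Y.\<close>

lemma factor_vanishes_along:
  assumes h: "irreducible_in (mpolys {0, 1}) h" "dvd_in (mpolys {0, 1}) h (at_Z \<eta> \<chi>)"
  obtains x where "poly \<chi>\<^sub>0 x = 0" "vanishes_along \<eta> h x"
proof -
  obtain g where g: "at_Z \<eta> \<chi> = h * g"
    using h(2) by (auto simp: dvd_in_def)
  interpret at: comm_ring_hom "at_XY \<eta>" by (rule comm_ring_hom_at_XY)
  interpret e0: comm_ring_hom "map_poly (\<lambda>q :: 'k alg_closure poly. poly q 0)"
    by (rule comm_ring_hom_map_poly[OF comm_ring_hom_poly])
  define A B where "A = at_XY \<eta> h" and "B = at_XY \<eta> g"
  have AB: "at_XY \<eta> \<chi> = A * B"
    using at_XY_at_Z[of \<eta> \<chi>] g by (simp add: at.hom_mult A_def B_def)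
  obtain c where c: "c \<noteq> 0" "Polynomial.lead_coeff (at_XY \<eta> \<chi>) = [:c:]"
    by (rule at_XY_chi_lead)
  have lc: "Polynomial.lead_coeff A * Polynomial.lead_coeff B = [:c:]"
    using c AB by (simp add: lead_coeff_mult)
  then have nz: "Polynomial.lead_coeff A \<noteq> 0" "Polynomial.lead_coeff B \<noteq> 0"
    using c(1) by (metis mult_zero_left mult_zero_right pCons_eq_0_iff)+
  \<comment> \<open>The two leading coefficients are polynomials in Y with constant nonzero product,
    so each is constant.\<close>
  have "Polynomial.degree (Polynomial.lead_coeff A) = 0"
    using degree_mult_eq[OF nz] lc by simp
  then obtain a where a: "Polynomial.lead_coeff A = [:a:]"
    by (rule degree_eq_zeroE)
  have "a \<noteq> 0"
    using nz(1) a by auto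
  have "0 < Polynomial.degree A"
  proof (rule ccontr)
    assume "\<not> 0 < Polynomial.degree A"
    then have "A = [:[:a:]:]"
      using a by (auto elim!: degree_eq_zeroE)
    moreover have "h \<in> mpolys {0, 1}"
      using h(1) by (simp add: irreducible_in_def)
    ultimately have "h = Const a"
      using at_XY_inverse[of h \<eta>]
      by (simp add: A_def map_poly_hom_pCons[OF comm_ring_hom_Const]
          map_poly_hom_pCons[OF comm_ring_hom_map_poly[OF comm_ring_hom_Const]])
    then show False
      using irreducible_in_imp_irreducible[OF h(1)] Const_dvd_1[OF \<open>a \<noteq> 0\<close>]
      by (auto simp: irreducible_def)
  qed
  define s t where "s = map_poly (\<lambda>q. poly q 0) A" and "t = map_poly (\<lambda>q. poly q 0) B"
  have st: "\<chi>\<^sub>0 = s * t"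
    using map_poly_at_XY_chi[of \<eta>] AB by (simp add: e0.hom_mult s_def t_def)
  \<comment> \<open>A constant leading coefficient survives Y = 0, so \<open>s\<close> keeps the
    positive degree of \<open>A\<close> and has a root.\<close>
  have "poly (Polynomial.lead_coeff A) 0 \<noteq> 0"
    using a \<open>a \<noteq> 0\<close> by simp
  from degree_map_poly_eq(1)[OF comm_ring_hom_poly this] have "0 < Polynomial.degree s"
    using \<open>0 < Polynomial.degree A\<close> by (simp add: s_def)
  then obtain x where x: "poly s x = 0"
    using alg_closed_imp_poly_has_root by blast
  then have root: "poly \<chi>\<^sub>0 x = 0"
    by (simp add: st)
  have tx: "poly t x \<noteq> 0"
    using chi0_simple_root[OF root] x by (auto simp: st pderiv_mult)
  have hom: "comm_ring_hom (subst (\<lambda>c. c) \<eta>)"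
    by (rule comm_ring_hom_subst[OF comm_ring_hom_id])
  have "vanishes_along \<eta> h x"
    unfolding vanishes_along_def
  proof (intro allI impI)
    fix \<alpha> :: "(nat, 'k alg_closure) mpoly poly" and K k
    assume \<alpha>: "Polynomial.coeff \<alpha> 0 = Const x" "Polynomial.monom 1 (Suc K) dvd ev_X \<alpha> \<chi>" and k: "k \<le> K"
    interpret s: comm_ring_hom "subst (\<lambda>c. c) \<eta>" by (rule hom)
    define \<beta> where "\<beta> = map_poly (subst (\<lambda>c. c) \<eta>) \<alpha>"
    have eq: "poly A \<beta> * poly B \<beta> = map_poly (subst (\<lambda>c. c) \<eta>) (ev_X \<alpha> \<chi>)"
      using poly_at_XY[OF hom, of \<chi> \<alpha>] by (simp add: AB \<beta>_def)
    have "Polynomial.coeff (poly A \<beta> * poly B \<beta>) l = 0" if "l < Suc K" for l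
      using \<alpha>(2) that unfolding eq by (simp add: coeff_map_poly monom_1_dvd_iff')
    moreover have "poly \<beta> 0 = x"
      using \<alpha>(1) by (simp add: \<beta>_def poly_0_coeff_0 coeff_map_poly subst_Const[OF comm_ring_hom_id])
    then have "poly (poly B \<beta>) 0 = poly t x"
      using poly_map_poly_hom[OF comm_ring_hom_poly, of 0 B \<beta>] by (simp only: t_def)
    then have "Polynomial.coeff (poly B \<beta>) 0 \<noteq> 0"
      using tx by (simp add: poly_0_coeff_0)
    ultimately have "Polynomial.coeff (poly A \<beta>) k = 0"
      using k by (intro coeff_mult_eq_0D[of "poly B \<beta>" "Suc K" "poly A \<beta>" k]) auto
    then show "Polynomial.coeff (poly (at_XY \<eta> h) (map_poly (subst (\<lambda>c. c) \<eta>) \<alpha>)) k = 0"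
      by (simp add: A_def \<beta>_def)
  qed
  with root show ?thesis
    by (rule that)
qed

text \<open>Row k of the linear system has entries of degree at most k in Z. A minor uses N distinct
  rows with k at most K = 2D\<delta>, so its degree is at most NK - N(N-1)/2; the bound is stated in
  doubled form.\<close>

lemma minor_exists:
  assumes D: "D < \<delta>" and root: "poly \<chi>\<^sub>0 x = 0"
  defines "N \<equiv> (D + 1) * (D + 2) div 2"
  obtains \<Psi> where "\<Psi> \<in> mpolys {2..n}" "\<Psi> \<noteq> 0"
    "2 * total_degree \<Psi> + N * (N - 1) \<le> 2 * (N * (2 * D * \<delta>))"
    "\<And>\<eta> h. h \<in> mpolys {0, 1} \<Longrightarrow> h \<noteq> 0 \<Longrightarrow> total_degree h \<le> D \<Longrightarrow> vanishes_along \<eta> h x \<Longrightarrow>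
       subst (\<lambda>c. c) \<eta> \<Psi> = 0"
proof -
  define K where "K = 2 * D * \<delta>"
  obtain \<alpha> where \<alpha>: "\<And>k. Polynomial.coeff \<alpha> k \<in> mpolys {2..n}"
    "\<And>k. total_degree (Polynomial.coeff \<alpha> k) \<le> k"
    "Polynomial.coeff \<alpha> 0 = Const x" "Polynomial.monom 1 (Suc K) dvd ev_X \<alpha> \<chi>"
    using newton_lift[OF root, of K] by blast
  obtain e where e: "bij_betw e {..<N} {(a, b). a + b \<le> D}"
    using ex_bij_betw_nat_finite[OF finite_pairs_le[of D]]
    unfolding card_pairs_le N_def atLeast0LessThan by blast
  let ?a = "\<lambda>j. fst (e j)" and ?b = "\<lambda>j. snd (e j)"
  have ab: "?a j + ?b j \<le> D" if "j < N" for j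
    using bij_betwE[OF e] that by (simp add: case_prod_beta)
  let ?F = "\<lambda>k. {p :: (nat, 'k alg_closure) mpoly. p \<in> mpolys {2..n} \<and> total_degree p \<le> k}"
  interpret F: filtration ?F by (rule filtration_mpolys_total_degree)
  interpret W: filtration "\<lambda>_. {p. \<forall>i. Polynomial.coeff p i \<in> ?F i}"
    by (rule F.filtration_graded_coeffs)
  let ?W = "{p. \<forall>i. Polynomial.coeff p i \<in> ?F i}"
  define M where "M k j = Polynomial.coeff (\<alpha> ^ ?a j * Polynomial.monom 1 (?b j)) k" for k j
  have M: "M k j \<in> mpolys {2..n} \<and> total_degree (M k j) \<le> k" for k j
  proof -
    have "\<alpha> \<in> ?W" "Polynomial.monom 1 (?b j) \<in> ?W"
      using \<alpha>(1,2) F.zero_in F.one_in by auto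
    then have "\<alpha> ^ ?a j * Polynomial.monom 1 (?b j) \<in> ?W"
      by (intro W.mult_in W.power_in)
    then show ?thesis by (simp add: M_def)
  qed
  have "\<not> (\<exists>c. (\<exists>j<N. c j \<noteq> 0) \<and> (\<forall>j<N. c j \<in> mpolys {2..n}) \<and> (\<forall>k\<in>{..K}. (\<Sum>j<N. M k j * c j) = 0))"
  proof
    assume "\<exists>c. (\<exists>j<N. c j \<noteq> 0) \<and> (\<forall>j<N. c j \<in> mpolys {2..n}) \<and> (\<forall>k\<in>{..K}. (\<Sum>j<N. M k j * c j) = 0)"
    then obtain c i where c: "i < N" "c i \<noteq> 0" "\<And>j. j < N \<Longrightarrow> c j \<in> mpolys {2..n}"
      "\<And>k. k \<le> K \<Longrightarrow> (\<Sum>j<N. M k j * c j) = 0"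
      by auto
    \<comment> \<open>A kernel vector is read as the coefficients of a polynomial in X, Y over the
      polynomials in Z.\<close>
    define h where "h = (\<Sum>j<N. c j * (Var 0 ^ ?a j * Var 1 ^ ?b j))"
    \<comment> \<open>Any filtration with Z at level 0 and X, Y at level 1 contains \<open>h\<close>
      at level D. Membership and all degree bounds required of \<open>h\<close> are
      instances.\<close>
    have h_in: "h \<in> G D" if "filtration G" "\<And>p. p \<in> mpolys {2..n} \<Longrightarrow> p \<in> G 0" "Var 0 \<in> G 1" "Var 1 \<in> G 1" for G
    proof -
      interpret filtration G by fact
      have "c j * (Var 0 ^ ?a j * Var 1 ^ ?b j) \<in> G (0 + (?a j * 1 + ?b j * 1))" if "j < N" for j
        using c(3) that \<open>\<And>p. p \<in> mpolys {2..n} \<Longrightarrow> p \<in> G 0\<close> \<open>Var 0 \<in> G 1\<close> \<open>Var 1 \<in> G 1\<close>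
        by (intro mult_in power_in) auto
      then have "c j * (Var 0 ^ ?a j * Var 1 ^ ?b j) \<in> G D" if "j < N" for j
        using that ab[OF that] mono_in[of "?a j + ?b j" D] by fastforce
      then show ?thesis
        unfolding h_def by (intro sum_in) auto
    qed
    interpret ev: comm_ring_hom "ev_X \<alpha>" by (rule comm_ring_hom_ev_X)
    interpret lift: comm_ring_hom "lift_XY :: (nat, 'k alg_closure) mpoly \<Rightarrow> _"
      by (rule comm_ring_hom_lift_XY)
    have "ev_X \<alpha> h = (\<Sum>j<N. smult (c j) (\<alpha> ^ ?a j * Polynomial.monom 1 (?b j)))"
      unfolding h_def ev.hom_sum
      by (intro sum.cong) (auto simp: ev.hom_mult ev.hom_power ev_X_free[OF c(3)] ev_X_simps monom_altdef)
    then have "Polynomial.coeff (ev_X \<alpha> h) k = (\<Sum>j<N. M k j * c j)" for k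
      by (simp add: Polynomial.coeff_sum M_def mult.commute)
    then have ev_h: "Polynomial.monom 1 (Suc K) dvd ev_X \<alpha> h"
      using c(4) by (simp add: monom_1_dvd_iff')
    have free: "as_poly_in 0 p = [:p:]" "as_poly_in (Suc 0) p = [:p:]" if "p \<in> mpolys {2..n}"
      for p :: "(nat, 'k alg_closure) mpoly"
      using as_poly_in_free[OF that] by auto
    have "h = 0"
    proof (rule no_small_relation[OF D _ _ ])
      show "Polynomial.monom 1 (Suc (2 * D * \<delta>)) dvd ev_X \<alpha> \<chi>"
        "Polynomial.monom 1 (Suc (2 * D * \<delta>)) dvd ev_X \<alpha> h"
        using \<alpha>(4) ev_h by (simp_all add: K_def)
      show "h \<in> mpolys (insert 0 (insert 1 {2..n}))"
        by (rule h_in[OF filtration_mpolys]) (auto intro: mpolys_mono)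
      have "h \<in> {p. deg_in 0 p \<le> D}"
        by (rule h_in[OF filtration_deg_in]) (auto simp: deg_in_def free as_poly_in_Var)
      then show "deg_in 0 h \<le> D" by simp
      have "h \<in> {p. \<forall>i. deg_in 1 (Polynomial.coeff (as_poly_in 0 p) i) \<le> D}"
        by (rule h_in[OF filtration_deg_in_coeffs])
          (auto simp: deg_in_def free as_poly_in_Var coeff_pCons split: nat.splits)
      then show "deg_in 1 (Polynomial.coeff (as_poly_in 0 h) i) \<le> D" for i by simp
      have "h \<in> {p. Polynomial.degree (XY_graded p) \<in> {..D}}"
        using h_in[OF filtration.filtration_vimage[OF filtration_degree comm_ring_hom_XY_graded]]
        by (auto simp: XY_graded_free XY_graded_Var)
      then show "Polynomial.degree (XY_graded h) \<le> D" by simp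
    qed
    \<comment> \<open>The \<open>c j\<close> involve only Z, so distinct exponent pairs occupy
      distinct places in the nested polynomial and each \<open>c j\<close> can be read off.\<close>
    then have "lift_XY h = 0"
      by simp
    moreover have "lift_XY h = (\<Sum>j<N. Polynomial.monom (Polynomial.monom (c j) (?b j)) (?a j))"
      unfolding h_def lift.hom_sum
    proof (intro sum.cong refl)
      fix j assume "j \<in> {..<N}"
      have "lift_XY (c j * (Var 0 ^ ?a j * Var 1 ^ ?b j)) =
          [:[:c j:]:] * ([:0, 1:] ^ ?a j * [:[:0, 1:] ^ ?b j:])"
        using lift_XY_free[OF c(3), of j] \<open>j \<in> {..<N}\<close>
        by (simp add: lift.hom_mult lift.hom_power lift_XY_simps poly_const_pow)
      then show "lift_XY (c j * (Var 0 ^ ?a j * Var 1 ^ ?b j)) =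
          Polynomial.monom (Polynomial.monom (c j) (?b j)) (?a j)"
        by (simp add: monom_altdef mult.commute)
    qed
    ultimately have "0 = Polynomial.coeff (Polynomial.coeff
        (\<Sum>j<N. Polynomial.monom (Polynomial.monom (c j) (?b j)) (?a j)) (?a i)) (?b i)"
      by simp
    also have "\<dots> = (\<Sum>j<N. if j = i then c i else 0)"
      unfolding Polynomial.coeff_sum
    proof (intro sum.cong refl)
      fix j assume "j \<in> {..<N}"
      then have "?a j = ?a i \<and> ?b j = ?b i \<longleftrightarrow> j = i"
        using bij_betw_imp_inj_on[OF e] c(1) by (auto simp: inj_on_def prod_eq_iff)
      then show "Polynomial.coeff (Polynomial.coeff (Polynomial.monom (Polynomial.monom (c j) (?b j)) (?a j)) (?a i)) (?b i)
          = (if j = i then c i else 0)"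
        by auto
    qed
    finally show False
      using c(1,2) by simp
  qed
  then obtain r where r: "\<And>i. i < N \<Longrightarrow> r i \<le> K" "det (mat N N (\<lambda>(i, j). M (r i) j)) \<noteq> 0"
    using minor_or_kernel[OF filtration_mpolys, of "{..K}" N M "{2..n}"] M by auto
  let ?A = "mat N N (\<lambda>(i, j). M (r i) j)"
  have "det ?A \<in> ?F (\<Sum>i<N. r i)"
    by (rule F.det_in) (use M in auto)
  then have det: "det ?A \<in> mpolys {2..n}" "total_degree (det ?A) \<le> (\<Sum>i<N. r i)"
    by auto
  show ?thesis
  proof (rule that[OF det(1) r(2)])
    show "2 * total_degree (det ?A) + N * (N - 1) \<le> 2 * (N * (2 * D * \<delta>))"
      using sum_distinct_le[of r N K] inj_on_rows_of_det_nonzero[where M = M, OF r(2)] r(1) det(2)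
      by (simp add: K_def)
    fix \<eta> h
    assume h: "h \<in> mpolys {0, 1}" "h \<noteq> 0" "total_degree h \<le> D" and van: "vanishes_along \<eta> h x"
    have hom: "comm_ring_hom (subst (\<lambda>c. c) \<eta>)"
      by (rule comm_ring_hom_subst[OF comm_ring_hom_id])
    interpret s: comm_ring_hom "subst (\<lambda>c. c) \<eta>" by (rule hom)
    interpret ms: comm_ring_hom "map_poly (subst (\<lambda>c. c) \<eta>)"
      by (rule comm_ring_hom_map_poly[OF hom])
    define \<beta> where "\<beta> = map_poly (subst (\<lambda>c. c) \<eta>) \<alpha>"
    define c where "c j = Poly_Mapping.lookup h
      (Poly_Mapping.single 0 (?a j) + Poly_Mapping.single 1 (?b j))" for j
    have nz: "\<exists>j<N. c j \<noteq> 0"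
      using poly_at_XY_eq_sum(2)[OF e h(1,3,2)] by (simp add: c_def)
    have entry: "subst (\<lambda>c. c) \<eta> (M k j) = Polynomial.coeff (\<beta> ^ ?a j * Polynomial.monom 1 (?b j)) k" for k j
    proof -
      have "\<beta> ^ ?a j * Polynomial.monom 1 (?b j) =
          map_poly (subst (\<lambda>c. c) \<eta>) (\<alpha> ^ ?a j * Polynomial.monom 1 (?b j))"
        by (simp add: ms.hom_mult ms.hom_power \<beta>_def map_poly_monom)
      then show ?thesis
        by (simp add: M_def coeff_map_poly)
    qed
    have rel: "(\<Sum>j<N. subst (\<lambda>c. c) \<eta> (M k j) * c j) = 0" if "k \<le> K" for k
    proof -
      have "(\<Sum>j<N. subst (\<lambda>c. c) \<eta> (M k j) * c j) = Polynomial.coeff (poly (at_XY \<eta> h) \<beta>) k"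
        unfolding poly_at_XY_eq_sum(1)[OF e h(1,3)] entry
        by (simp add: Polynomial.coeff_sum c_def mult.commute)
      also have "\<dots> = 0"
        using van \<alpha>(3,4) that unfolding vanishes_along_def \<beta>_def by blast
      finally show ?thesis .
    qed
    \<comment> \<open>The coefficients of \<open>h\<close> form a nonzero kernel vector of the
      specialized matrix, and determinants commute with specialization.\<close>
    let ?B = "map_mat (subst (\<lambda>c. c) \<eta>) ?A"
    have "vec N c \<noteq> 0\<^sub>v N"
      using nz by (metis index_vec index_zero_vec(1))
    moreover have "?B *\<^sub>v vec N c = 0\<^sub>v N"
    proof (rule eq_vecI)
      fix i assume "i < dim_vec (0\<^sub>v N :: 'k alg_closure vec)"
      then have i: "i < N" by simp
      then have "(?B *\<^sub>v vec N c) $ i = (\<Sum>j<N. subst (\<lambda>c. c) \<eta> (M (r i) j) * c j)"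
        by (auto simp: scalar_prod_def atLeast0LessThan intro!: sum.cong)
      then show "(?B *\<^sub>v vec N c) $ i = 0\<^sub>v N $ i"
        using rel r(1) i by simp
    qed simp
    ultimately have "det ?B = 0"
      by (subst det_0_iff_vec_prod_zero[of _ N]) (auto intro!: exI[of _ "vec N c"])
    then show "subst (\<lambda>c. c) \<eta> (det ?A) = 0"
      by simp
  qed
qed

end

section \<open>Product of the minors over all roots, and its degree\<close>

theorem theorem3p3:
  fixes f :: "(nat, 'k::field) mpoly"
    and \<Upsilon> :: "(nat + nat, 'k) mpoly"
    and \<nu> \<omega> :: "nat \<Rightarrow> 'k alg_closure"
    and n \<delta> D :: nat
  assumes "1 \<le> n"
    and "f \<in> mpolys {1..n}"
    and "absolutely_irreducible {1..n} f"
    and "total_degree f = \<delta>"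
    and "1 \<le> D" and "D \<le> \<delta> - 1"
    and "\<Upsilon> \<in> mpolys (Inl ` {1..n} \<union> Inr ` {2..n})"
    and "\<Upsilon> \<noteq> 0"
    and "total_degree \<Upsilon> \<le> 2 * \<delta>\<^sup>2"
    and "\<And>\<nu>' \<omega>'. subst to_ac (case_sum \<nu>' \<omega>') \<Upsilon> \<noteq> 0 \<Longrightarrow> good_point n f \<nu>' \<omega>'"
    and "subst to_ac (case_sum \<nu> \<omega>) \<Upsilon> \<noteq> 0"
  shows "\<exists>\<Psi> :: (nat, 'k alg_closure) mpoly.
           \<Psi> \<in> mpolys {2..n} \<and> \<Psi> \<noteq> 0 \<and>
           real (total_degree \<Psi>) \<le>
             real D * real \<delta> ^ 2 * (real D + 1) * (real D + 2)
             - (real D ^ 2 + 3 * real D) * (real D ^ 2 + 3 * real D + 2) * real \<delta> / 8 \<and>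
           (\<forall>\<eta> :: nat \<Rightarrow> 'k alg_closure. subst (\<lambda>c. c) \<eta> \<Psi> \<noteq> 0 \<longrightarrow>
              \<not> (\<exists>h. irreducible_in (mpolys {X_ix, Y_ix}) h \<and>
                     dvd_in (mpolys {X_ix, Y_ix}) h (at_Z \<eta> (chi f \<nu> \<omega>)) \<and>
                     total_degree h \<le> D))"
proof -
  interpret good_specialization f \<nu> \<omega> n \<delta>
    by unfold_locales (use assms in auto)
  have D: "D < \<delta>"
    using assms(5,6) by simp
  define N where "N = (D + 1) * (D + 2) div 2"
  have "2 dvd (D + 1) * (D + 2)"
    by simp
  then have N: "2 * N = (D + 1) * (D + 2)"
    unfolding N_def by (rule dvd_mult_div_cancel)
  define R where "R = {x. poly \<chi>\<^sub>0 x = 0}"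
  have R: "finite R" "card R \<le> \<delta>"
    using poly_roots_finite[OF chi0_nonzero] card_poly_roots_bound[OF chi0_nonzero]
      degree_chi0 deg_in_chi_le by (simp_all add: R_def)
  let ?P = "\<lambda>x \<Psi>. \<Psi> \<in> mpolys {2..n} \<and> \<Psi> \<noteq> 0 \<and>
    2 * total_degree \<Psi> + N * (N - 1) \<le> 2 * (N * (2 * D * \<delta>)) \<and>
    (\<forall>\<eta> h. h \<in> mpolys {0, 1} \<longrightarrow> h \<noteq> 0 \<longrightarrow> total_degree h \<le> D \<longrightarrow> vanishes_along \<eta> h x \<longrightarrow>
       subst (\<lambda>c. c) \<eta> \<Psi> = 0)"
  have "\<forall>x\<in>R. \<exists>\<Psi>. ?P x \<Psi>"
  proof
    fix x assume "x \<in> R"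
    then have root: "poly \<chi>\<^sub>0 x = 0"
      by (simp add: R_def)
    show "\<exists>\<Psi>. ?P x \<Psi>"
    proof (rule minor_exists[OF D root, folded N_def], intro exI conjI allI impI)
      fix \<Psi> \<eta> h
      assume *: "\<And>\<eta> h. h \<in> mpolys {0, 1} \<Longrightarrow> h \<noteq> 0 \<Longrightarrow> total_degree h \<le> D \<Longrightarrow>
        vanishes_along \<eta> h x \<Longrightarrow> subst (\<lambda>c. c) \<eta> \<Psi> = 0"
      assume "h \<in> mpolys {0, 1}" "h \<noteq> 0" "total_degree h \<le> D" "vanishes_along \<eta> h x"
      then show "subst (\<lambda>c. c) \<eta> \<Psi> = 0"
        by (rule *)
    qed
  qed
  from bchoice[OF this] obtain \<Psi>' where \<Psi>'_ball: "\<forall>x\<in>R. ?P x (\<Psi>' x)"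
    by (rule exE)
  note \<Psi>' = bspec[OF \<Psi>'_ball]
  \<comment> \<open>The bound NK - N(N-1)/2 for a single root, with K = 2D\<delta>. Halving is
    exact, since N(N-1) is even.\<close>
  define B where "B = (2 * (N * (2 * D * \<delta>)) - N * (N - 1)) div 2"
  define \<Psi> where "\<Psi> = (\<Prod>x\<in>R. \<Psi>' x)"
  have even: "even (N * (N - 1))"
    by (cases "even N") auto
  have le: "N * (N - 1) \<le> 2 * (N * (2 * D * \<delta>))" if "x \<in> R" for x
    using \<Psi>'[OF that] by linarith
  have deg: "total_degree (\<Psi>' x) \<le> B" if "x \<in> R" for x
    using \<Psi>'[OF that] unfolding B_def by linarith
  interpret F: filtration "\<lambda>k. {p :: (nat, 'k alg_closure) mpoly. p \<in> mpolys {2..n} \<and> total_degree p \<le> k}"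
    by (rule filtration_mpolys_total_degree)
  have "\<Psi> \<in> {p. p \<in> mpolys {2..n} \<and> total_degree p \<le> (\<Sum>x\<in>R. B)}"
    unfolding \<Psi>_def using \<Psi>' deg by (intro F.prod_in) auto
  then have \<Psi>_in: "\<Psi> \<in> mpolys {2..n}" and \<Psi>_deg: "total_degree \<Psi> \<le> card R * B"
    by auto
  \<comment> \<open>The degree bound of the minor at any one root shows that the subtraction in
    \<open>B\<close> is not truncated.\<close>
  have "R \<noteq> {}"
  proof -
    have "0 < Polynomial.degree \<chi>\<^sub>0"
      using degree_chi0 deg_in_chi_pos by simp
    then show ?thesis
      using alg_closed_imp_poly_has_root by (auto simp: R_def)
  qed
  then have N_le: "N * (N - 1) \<le> 2 * (N * (2 * D * \<delta>))"
    using le by blast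
  have "\<Psi> \<noteq> 0"
    using \<Psi>' R by (auto simp: \<Psi>_def)
  moreover have "real (total_degree \<Psi>) \<le>
      real D * real \<delta> ^ 2 * (real D + 1) * (real D + 2)
      - (real D ^ 2 + 3 * real D) * (real D ^ 2 + 3 * real D + 2) * real \<delta> / 8"
  proof -
    have "total_degree \<Psi> \<le> \<delta> * B"
      using \<Psi>_deg R(2) by (meson mult_le_mono1 order.trans)
    then have "real (total_degree \<Psi>) \<le> real \<delta> * real B"
      by (metis of_nat_le_iff of_nat_mult)
    also have "real B = real N * (2 * real D * real \<delta>) - real N * (real N - 1) / 2"
    proof -
      have "even (2 * (N * (2 * D * \<delta>)) - N * (N - 1))"
        using even by simp
      then have "2 * B + N * (N - 1) = 2 * (N * (2 * D * \<delta>))"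
        unfolding B_def using N_le by simp
      then have "real (2 * B + N * (N - 1)) = real (2 * (N * (2 * D * \<delta>)))"
        by (rule arg_cong)
      then have "2 * real B + real N * real (N - 1) = 2 * (real N * (2 * real D * real \<delta>))"
        by (simp only: of_nat_add of_nat_mult of_nat_numeral)
      moreover have "1 \<le> N"
        using N by (cases N) auto
      then have "real (N - 1) = real N - 1"
        by simp
      ultimately show ?thesis
        by (simp only: field_simps)
    qed
    \<comment> \<open>From 2N = (D+1)(D+2) follows 2(N-1) = D^2 + 3D, so N(N-1)/2 produces the
      divisor 8.\<close>
    also have "real N = (real D + 1) * (real D + 2) / 2"
      using arg_cong[OF N, of real] by (simp add: algebra_simps)
    also have "real \<delta> * ((real D + 1) * (real D + 2) / 2 * (2 * real D * real \<delta>)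
        - (real D + 1) * (real D + 2) / 2 * ((real D + 1) * (real D + 2) / 2 - 1) / 2) =
      real D * real \<delta> ^ 2 * (real D + 1) * (real D + 2)
      - (real D ^ 2 + 3 * real D) * (real D ^ 2 + 3 * real D + 2) * real \<delta> / 8"
      by (simp add: field_simps power2_eq_square)
    finally show ?thesis .
  qed
  moreover have "\<not> (\<exists>h. irreducible_in (mpolys {X_ix, Y_ix}) h \<and>
      dvd_in (mpolys {X_ix, Y_ix}) h (at_Z \<eta> (chi f \<nu> \<omega>)) \<and> total_degree h \<le> D)"
    if \<eta>: "subst (\<lambda>c. c) \<eta> \<Psi> \<noteq> 0" for \<eta> :: "nat \<Rightarrow> 'k alg_closure"
  proof
    assume "\<exists>h. irreducible_in (mpolys {X_ix, Y_ix}) h \<and>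
      dvd_in (mpolys {X_ix, Y_ix}) h (at_Z \<eta> (chi f \<nu> \<omega>)) \<and> total_degree h \<le> D"
    then obtain h where h: "irreducible_in (mpolys {0, 1}) h"
      "dvd_in (mpolys {0, 1}) h (at_Z \<eta> \<chi>)" "total_degree h \<le> D"
      by auto
    obtain x where x: "poly \<chi>\<^sub>0 x = 0" "vanishes_along \<eta> h x"
      by (rule factor_vanishes_along[OF h(1,2)])
    have "x \<in> R"
      using x by (simp add: R_def)
    moreover have "h \<in> mpolys {0, 1}" "h \<noteq> 0"
      using h(1) by (simp_all add: irreducible_in_def)
    ultimately have zero: "subst (\<lambda>c. c) \<eta> (\<Psi>' x) = 0"
      using \<Psi>' x h(3) by blast
    interpret s: comm_ring_hom "subst (\<lambda>c. c) \<eta>"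
      by (rule comm_ring_hom_subst[OF comm_ring_hom_id])
    have "subst (\<lambda>c. c) \<eta> \<Psi> = (\<Prod>x\<in>R. subst (\<lambda>c. c) \<eta> (\<Psi>' x))"
      unfolding \<Psi>_def by (rule s.hom_prod)
    also have "\<dots> = 0"
      using \<open>x \<in> R\<close> zero R(1) by (intro prod_zero) auto
    finally show False
      using \<eta> by simp
  qed
  ultimately show ?thesis
    using \<Psi>_in by blast
qed

end
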